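(* Let $n\ge3$ and let $f:S^{n-1}\to\mathbb{R}$ be a Lipschitz function with Lipschitz constant $\kappa$. If $d=2k$ with $k$ a positive integer, then there exists a univariate polynomial $u(t)$ of degree $d$ which is nonnegative on $[-1,1]$ and such that \[ \|f-T_u(f)\|_\infty\ \le\ \left(\frac{\pi}{\sqrt2}\sqrt{1-\lambda_{k+1}}\right)\kappa . \] Furthermore, the right-hand side behaves as $\frac{\pi(n-2)}{\sqrt2}\frac{\kappa}{d}$ as $d\to\infty$, in the sense that (for $\kappa>0$) the limsup, as $d=2k\to\infty$, of the ratio of $\left(\frac{\pi}{\sqrt2}\sqrt{1-\lambda_{k+1}}\right)\kappa$ to $\frac{\pi(n-2)}{\sqrt2}\frac{\kappa}{d}$ is finite.
   Context: $S^{n-1}\subset\mathbb{R}^n$ is the unit sphere with its volume (surface) measure $\mu$; Lipschitz continuity is with respect to the geodesic distance $d(x,y)=\arccos\langle x,y\rangle$; $\|\cdot\|_\infty$ is the supremum norm. For a univariate polynomial $u$ nonnegative on $[-1,1]$, $T_u$ is the convolution operator on $L^2(S^{n-1},\mu)$ defined by \[ T_u(f)(x)=\int_{S^{n-1}}u(\langle x,y\rangle)f(y)\,d\mu(y). \] Put $\alpha=\frac{n-2}{2}$; $\lambda_j$ denotes the largest root of the Gegenbauer polynomial $C_j^{(\alpha)}(t)$, defined by $C_0^{(\alpha)}=1$, $C_1^{(\alpha)}=2\alpha t$, and $C_j^{(\alpha)}(t)=\frac1j\left[2t(j+\alpha-1)C_{j-1}^{(\alpha)}(t)-(j+2\alpha-2)C_{j-2}^{(\alpha)}(t)\right]$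 for $j\ge2$. *)

theory Defs
  imports "HOL-Analysis.Analysis" "HOL-Computational_Algebra.Polynomial"
begin

abbreviation unit_sphere :: "(real ^ 'n) set" where
  "unit_sphere \<equiv> sphere 0 1"

text \<open>
  The surface measure is given by the cone formula (polar coordinates): the area of \<open>A\<close> is
  \<open>n\<close> times the volume of the cone \<open>{r x | 0 < r \<le> 1, x \<in> A}\<close>; see
  \<open>emeasure_sphere_measure\<close> below.  It is not normalised, so the whole sphere has measure
  \<open>n\<close> times the volume of the unit ball.
\<close>
definition sphere_measure :: "(real ^ 'n) measure" where
  "sphere_measure =
     scale_measure (of_nat CARD('n))
       (distr (restrict_space lborel (cball 0 1 - {0})) (restrict_space borel unit_sphere)
         (\<lambda>x. x /\<^sub>R norm x))"

lemma space_sphere_measure [simp]: "space (sphere_measure :: (real ^ 'n) measure) = unit_sphere"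
  by (simp add: sphere_measure_def space_scale_measure space_restrict_space)

lemma sets_sphere_measure:
  "sets (sphere_measure :: (real ^ 'n) measure) = sets (restrict_space borel unit_sphere)"
  by (simp add: sphere_measure_def)

lemma radial_projection_measurable:
  "(\<lambda>x. x /\<^sub>R norm x) \<in>
     restrict_space lborel (cball 0 1 - {0 :: real ^ 'n}) \<rightarrow>\<^sub>M restrict_space borel unit_sphere"
proof (rule measurable_restrict_space2)
  show "(\<lambda>x. x /\<^sub>R norm x) \<in>
      space (restrict_space lborel (cball 0 1 - {0 :: real ^ 'n})) \<rightarrow> unit_sphere"
    by (auto simp: space_restrict_space)
  show "(\<lambda>x. x /\<^sub>R norm x) \<in> borel_measurable (restrict_space lborel (cball 0 1 - {0 :: real ^ 'n}))"
    by (intro measurable_restrict_space1) measurable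
qed

lemma emeasure_sphere_measure:
  fixes A :: "(real ^ 'n) set"
  assumes "A \<in> sets borel" "A \<subseteq> unit_sphere"
  shows "emeasure sphere_measure A =
           of_nat CARD('n) * emeasure lborel {r *\<^sub>R x | r x. 0 < r \<and> r \<le> 1 \<and> x \<in> A}"
proof -
  have A: "A \<in> sets (restrict_space borel unit_sphere)"
    using assms by (simp add: sets_restrict_space_iff)
  have "(\<lambda>x. x /\<^sub>R norm x) -` A \<inter> (cball 0 1 - {0}) =
          {r *\<^sub>R x | r x. 0 < r \<and> r \<le> 1 \<and> x \<in> A}" (is "?L = ?R")
  proof
    show "?L \<subseteq> ?R"
    proof
      fix x assume "x \<in> ?L"
      then have "x = norm x *\<^sub>R (x /\<^sub>R norm x)" "0 < norm x" "norm x \<le> 1" "x /\<^sub>R norm x \<in> A"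
        by auto
      then show "x \<in> ?R" by blast
    qed
    show "?R \<subseteq> ?L"
    proof
      fix y assume "y \<in> ?R"
      then obtain r x where y: "y = r *\<^sub>R x" "0 < r" "r \<le> 1" "x \<in> A" by blast
      with assms(2) have "norm x = 1" by auto
      with y show "y \<in> ?L" by auto
    qed
  qed
  moreover have "emeasure (restrict_space lborel (cball 0 1 - {0})) ?R = emeasure lborel ?R"
    using assms(2) by (intro emeasure_restrict_space) auto
  ultimately show ?thesis
    unfolding sphere_measure_def emeasure_scale_measure
    using A by (simp add: emeasure_distr[OF radial_projection_measurable]
        space_restrict_space)
qed

definition geodesic_dist :: "real ^ 'n \<Rightarrow> real ^ 'n \<Rightarrow> real" where
  "geodesic_dist x y = arccos (x \<bullet> y)"

definition sphere_lipschitz :: "real \<Rightarrow> (real ^ 'n \<Rightarrow> real) \<Rightarrow> bool" where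
  "sphere_lipschitz \<kappa> f \<longleftrightarrow>
     0 \<le> \<kappa> \<and> (\<forall>x\<in>unit_sphere. \<forall>y\<in>unit_sphere. \<bar>f x - f y\<bar> \<le> \<kappa> * geodesic_dist x y)"

text \<open>
  The supremum is taken in the extended reals, so that it is meaningful for unbounded functions
  too.
\<close>
definition sphere_sup_norm :: "(real ^ 'n \<Rightarrow> real) \<Rightarrow> ereal" where
  "sphere_sup_norm f = (SUP x\<in>unit_sphere. ereal \<bar>f x\<bar>)"

definition convolution_op :: "real poly \<Rightarrow> (real ^ 'n \<Rightarrow> real) \<Rightarrow> real ^ 'n \<Rightarrow> real" where
  "convolution_op u f x = (LINT y|sphere_measure. poly u (x \<bullet> y) * f y)"

fun gegenbauer :: "real \<Rightarrow> nat \<Rightarrow> real poly" where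
  "gegenbauer \<alpha> 0 = 1"
| "gegenbauer \<alpha> (Suc 0) = [:0, 2 * \<alpha>:]"
| "gegenbauer \<alpha> (Suc (Suc i)) =
     (let j = real (Suc (Suc i)) in
       smult (1 / j)
         ([:0, 2 * (j + \<alpha> - 1):] * gegenbauer \<alpha> (Suc i)
           - smult (j + 2 * \<alpha> - 2) (gegenbauer \<alpha> i)))"

text \<open>For \<open>\<alpha> > 0\<close> and \<open>j \<ge> 1\<close> the root set is finite and non-empty.\<close>
definition largest_gegenbauer_root :: "real \<Rightarrow> nat \<Rightarrow> real" where
  "largest_gegenbauer_root \<alpha> j = Max {t. poly (gegenbauer \<alpha> j) t = 0}"

end

theory Submission
  imports Defs
begin

text \<open>
  Let \<open>\<lambda>\<close> be the largest root of \<open>C\<^sub>k\<^sub>+\<^sub>1\<close> and let \<open>u\<close> be \<open>(C\<^sub>k\<^sub>+\<^sub>1(t) / (t - \<lambda>))\<^sup>2\<close>, normalised so that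
  \<open>u(\<langle>x, y\<rangle>) d\<mu>(y)\<close> is a probability measure.  Since \<open>u(t) (t - \<lambda>)\<close> is \<open>C\<^sub>k\<^sub>+\<^sub>1\<close> times a polynomial of
  degree \<open>k\<close>, orthogonality shows that \<open>\<langle>x, y\<rangle>\<close> has mean \<open>\<lambda>\<close>.  As
  \<open>arccos t \<le> (\<pi> / \<surd>2) \<surd>(1 - t)\<close>, the error at \<open>x\<close> is at most \<open>\<kappa> \<pi> / \<surd>2\<close> times the mean of
  \<open>\<surd>(1 - \<langle>x, y\<rangle>)\<close>, and concavity of the square root gives the bound.

  Orthogonality uses no density: rotation invariance of \<open>\<mu>\<close> yields a recurrence for the moments of
  \<open>\<langle>x, y\<rangle>\<close>, which is integration by parts for polynomials; the Gegenbauer differential equation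
  then shows that every \<open>C\<^sub>j\<close> with \<open>j \<ge> 1\<close> has mean zero, and the three-term recurrence does the rest.

  For the asymptotics, the recurrence at \<open>t = \<lambda>\<close> has the positive solution \<open>C\<^sub>0(\<lambda>), \<dots>, C\<^sub>k(\<lambda>)\<close>, so a
  discrete Picone inequality bounds \<open>1 - \<lambda>\<close> by the Rayleigh quotient of any test vector; a bump on
  \<open>[k / 4, k]\<close> gives \<open>1 - \<lambda> = O(1 / k\<^sup>2)\<close>.
\<close>

section \<open>Identities for Gegenbauer polynomials\<close>

lemma gegenbauer_recurrence:
  "real (j + 2) * poly (gegenbauer \<alpha> (j + 2)) t =
     2 * (real j + 1 + \<alpha>) * t * poly (gegenbauer \<alpha> (j + 1)) t
       - (real j + 2 * \<alpha>) * poly (gegenbauer \<alpha> j) t"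
proof -
  have "poly (gegenbauer \<alpha> (j + 2)) t = 1 / real (j + 2) *
     (2 * (real j + 1 + \<alpha>) * t * poly (gegenbauer \<alpha> (j + 1)) t
       - (real j + 2 * \<alpha>) * poly (gegenbauer \<alpha> j) t)"
    by (simp add: Let_def algebra_simps)
  then show ?thesis by simp
qed

lemma smult_gegenbauer_recurrence:
  "smult (real (j + 2)) (gegenbauer \<alpha> (j + 2)) =
     smult (2 * (real j + 1 + \<alpha>)) ([:0, 1:] * gegenbauer \<alpha> (j + 1))
       - smult (real j + 2 * \<alpha>) (gegenbauer \<alpha> j)"
proof -
  have "poly (smult (real (j + 2)) (gegenbauer \<alpha> (j + 2))) =
     poly (smult (2 * (real j + 1 + \<alpha>)) ([:0, 1:] * gegenbauer \<alpha> (j + 1))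
       - smult (real j + 2 * \<alpha>) (gegenbauer \<alpha> j))"
    by (rule ext, simp only: poly_smult poly_diff gegenbauer_recurrence) simp
  then show ?thesis by (simp only: poly_eq_poly_eq_iff)
qed

lemma pderiv_gegenbauer_recurrence:
  "real (j + 2) * poly (pderiv (gegenbauer \<alpha> (j + 2))) t =
     2 * (real j + 1 + \<alpha>) *
         (poly (gegenbauer \<alpha> (j + 1)) t + t * poly (pderiv (gegenbauer \<alpha> (j + 1))) t)
       - (real j + 2 * \<alpha>) * poly (pderiv (gegenbauer \<alpha> j)) t"
proof -
  have "poly (pderiv (smult (real (j + 2)) (gegenbauer \<alpha> (j + 2)))) t =
     poly (pderiv (smult (2 * (real j + 1 + \<alpha>)) ([:0, 1:] * gegenbauer \<alpha> (j + 1))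
       - smult (real j + 2 * \<alpha>) (gegenbauer \<alpha> j))) t"
    by (simp only: smult_gegenbauer_recurrence)
  then show ?thesis
    by (simp only: pderiv_smult pderiv_diff pderiv_mult)
       (simp add: pderiv_pCons algebra_simps del: gegenbauer.simps)
qed

text \<open>Both relations go through one induction. Substituting the first at \<open>j\<close> into
  the differentiated recurrence gives the second at \<open>j + 1\<close>; the first at
  \<open>j + 1\<close> then follows from this, both relations at \<open>j\<close> and the
  recurrence. They serve to eliminate the derivative of \<open>C_j\<close> in what follows.\<close>

lemma gegenbauer_contiguous:
  shows "t * poly (pderiv (gegenbauer \<alpha> (j + 1))) t - poly (pderiv (gegenbauer \<alpha> j)) t
           = real (j + 1) * poly (gegenbauer \<alpha> (j + 1)) t"
    and "poly (pderiv (gegenbauer \<alpha> (j + 1))) t - t * poly (pderiv (gegenbauer \<alpha> j)) t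
           = (real j + 2 * \<alpha>) * poly (gegenbauer \<alpha> j) t"
proof -
  have "t * poly (pderiv (gegenbauer \<alpha> (j + 1))) t - poly (pderiv (gegenbauer \<alpha> j)) t
           = real (j + 1) * poly (gegenbauer \<alpha> (j + 1)) t \<and>
        poly (pderiv (gegenbauer \<alpha> (j + 1))) t - t * poly (pderiv (gegenbauer \<alpha> j)) t
           = (real j + 2 * \<alpha>) * poly (gegenbauer \<alpha> j) t"
  proof (induction j)
    case 0
    then show ?case by (simp add: pderiv_pCons)
  next
    case (Suc j)
    define c0 c1 c2 d0 d1 d2 r where "c0 = poly (gegenbauer \<alpha> j) t"
      and "c1 = poly (gegenbauer \<alpha> (j + 1)) t" and "c2 = poly (gegenbauer \<alpha> (j + 2)) t"
      and "d0 = poly (pderiv (gegenbauer \<alpha> j)) t"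
      and "d1 = poly (pderiv (gegenbauer \<alpha> (j + 1))) t"
      and "d2 = poly (pderiv (gegenbauer \<alpha> (j + 2))) t" and "r = real j"
    note defs = this
    have A: "t * d1 - d0 = (r + 1) * c1" and B: "d1 - t * d0 = (r + 2 * \<alpha>) * c0"
      using Suc unfolding defs by (simp_all del: gegenbauer.simps)
    have R: "(r + 2) * c2 = 2 * (r + 1 + \<alpha>) * t * c1 - (r + 2 * \<alpha>) * c0"
      using gegenbauer_recurrence[of j \<alpha> t] unfolding defs by (simp add: add_ac del: gegenbauer.simps)
    have R': "(r + 2) * d2 = 2 * (r + 1 + \<alpha>) * (c1 + t * d1) - (r + 2 * \<alpha>) * d0"
      using pderiv_gegenbauer_recurrence[of j \<alpha> t] unfolding defs by (simp add: add_ac del: gegenbauer.simps)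
    have r: "r + 2 \<noteq> 0" unfolding defs by simp
    have "(r + 2) * (d2 - t * d1) = (r + 2) * ((r + 1 + 2 * \<alpha>) * c1)"
      using A R' by algebra
    then have B': "d2 - t * d1 = (r + 1 + 2 * \<alpha>) * c1" using r by simp
    have A': "t * d2 - d1 = (r + 2) * c2"
      using A B B' R by algebra
    show ?case
      using A' B' unfolding defs by (simp add: add_ac del: gegenbauer.simps)
  qed
  then show "t * poly (pderiv (gegenbauer \<alpha> (j + 1))) t - poly (pderiv (gegenbauer \<alpha> j)) t
           = real (j + 1) * poly (gegenbauer \<alpha> (j + 1)) t"
    and "poly (pderiv (gegenbauer \<alpha> (j + 1))) t - t * poly (pderiv (gegenbauer \<alpha> j)) t
           = (real j + 2 * \<alpha>) * poly (gegenbauer \<alpha> j) t" by auto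
qed

text \<open>The second contiguous relation minus \<open>t\<close> times the first. At
  \<open>t = 1\<close> the left side vanishes, which ties consecutive values at 1 together.\<close>

lemma gegenbauer_pderiv_formula:
  "(1 - t\<^sup>2) * poly (pderiv (gegenbauer \<alpha> (j + 1))) t =
     (real j + 2 * \<alpha>) * poly (gegenbauer \<alpha> j) t - real (j + 1) * t * poly (gegenbauer \<alpha> (j + 1)) t"
  using gegenbauer_contiguous[where t = t and \<alpha> = \<alpha> and j = j] by algebra

text \<open>Differentiating \<open>gegenbauer_pderiv_formula\<close> brings in the derivative of
  \<open>C_j\<close>, which the first contiguous relation removes. With \<open>q\<close> the
  derivative of \<open>C_(j+1)\<close>, the left side is
  \<open>(1 - t^2) q' - (2 \<alpha> + 1) t q\<close>, the shape of
  \<open>zonal_integral_by_parts\<close>.\<close>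

lemma gegenbauer_ode:
  "[:1, 0, -1:] * pderiv (pderiv (gegenbauer \<alpha> (j + 1)))
     - smult (2 * \<alpha> + 1) ([:0, 1:] * pderiv (gegenbauer \<alpha> (j + 1)))
   = smult (- (real (j + 1) * (real (j + 1) + 2 * \<alpha>))) (gegenbauer \<alpha> (j + 1))"
proof -
  define C D where "C = gegenbauer \<alpha> (j + 1)" and "D = gegenbauer \<alpha> j"
  have "poly ([:1, 0, -1:] * pderiv C) = poly (smult (real j + 2 * \<alpha>) D - smult (real (j + 1)) ([:0, 1:] * C))"
    using gegenbauer_pderiv_formula[where \<alpha> = \<alpha> and j = j]
    by (intro ext) (simp add: C_def D_def power2_eq_square algebra_simps del: gegenbauer.simps)
  then have eq: "[:1, 0, -1:] * pderiv C = smult (real j + 2 * \<alpha>) D - smult (real (j + 1)) ([:0, 1:] * C)"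
    by (simp only: poly_eq_poly_eq_iff)
  have "poly ([:1, 0, -1:] * pderiv (pderiv C) - smult (2 * \<alpha> + 1) ([:0, 1:] * pderiv C)) t
      = poly (smult (- (real (j + 1) * (real (j + 1) + 2 * \<alpha>))) C) t" for t
  proof -
    have "poly (pderiv ([:1, 0, -1:] * pderiv C)) t
        = poly (pderiv (smult (real j + 2 * \<alpha>) D - smult (real (j + 1)) ([:0, 1:] * C))) t"
      by (simp only: eq)
    then have 1: "(1 - t * t) * poly (pderiv (pderiv C)) t - 2 * t * poly (pderiv C) t
        = (real j + 2 * \<alpha>) * poly (pderiv D) t - (real j + 1) * (poly C t + t * poly (pderiv C) t)"
      by (simp only: pderiv_mult pderiv_diff pderiv_smult) (simp add: pderiv_pCons algebra_simps)
    have 2: "t * poly (pderiv C) t - poly (pderiv D) t = (real j + 1) * poly C t"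
      using gegenbauer_contiguous(1)[where t = t and \<alpha> = \<alpha> and j = j] by (simp add: C_def D_def del: gegenbauer.simps)
    have "(1 - t * t) * poly (pderiv (pderiv C)) t - (2 * \<alpha> + 1) * (t * poly (pderiv C) t) =
      - ((real j + 1) * (real j + 1 + 2 * \<alpha>)) * poly C t"
      using 1 2 by algebra
    then show ?thesis by (simp add: algebra_simps)
  qed
  then show ?thesis
    unfolding C_def[symmetric] by (simp only: poly_eq_poly_eq_iff[symmetric]) (rule ext)
qed

lemma gegenbauer_at_1_pos:
  assumes "\<alpha> > 0"
  shows "poly (gegenbauer \<alpha> j) 1 > 0"
proof (induction j)
  case (Suc j)
  have "real (j + 1) * poly (gegenbauer \<alpha> (j + 1)) 1 = (real j + 2 * \<alpha>) * poly (gegenbauer \<alpha> j) 1"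
    using gegenbauer_pderiv_formula[where t = 1 and \<alpha> = \<alpha> and j = j] by simp
  moreover have "(real j + 2 * \<alpha>) * poly (gegenbauer \<alpha> j) 1 > 0"
    using Suc assms by simp
  ultimately have "0 < real (j + 1) * poly (gegenbauer \<alpha> (j + 1)) 1" by simp
  then have "0 < poly (gegenbauer \<alpha> (j + 1)) 1"
    by (rule zero_less_mult_pos) simp
  then show ?case by simp
qed simp

lemma gegenbauer_degree_lead_coeff:
  assumes "\<alpha> > 0"
  shows "degree (gegenbauer \<alpha> j) = j \<and> lead_coeff (gegenbauer \<alpha> j) > 0"
proof (induction j rule: less_induct)
  case (less j)
  show ?case
  proof (cases "j < 2")
    case True
    then have "j = 0 \<or> j = 1" by auto
    then show ?thesis using assms by auto
  next
    case False
    then obtain i where j: "j = i + 2"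
      using le_Suc_ex[of 2 j] by (auto simp: add.commute)
    define p where "p = smult (2 * (real i + 1 + \<alpha>)) ([:0, 1:] * gegenbauer \<alpha> (i + 1))"
    define q where "q = smult (real i + 2 * \<alpha>) (gegenbauer \<alpha> i)"
    have IH: "degree (gegenbauer \<alpha> (i + 1)) = i + 1" "lead_coeff (gegenbauer \<alpha> (i + 1)) > 0"
       "degree (gegenbauer \<alpha> i) = i"
      using less[of "i + 1"] less[of i] j by auto
    then have nz: "gegenbauer \<alpha> (i + 1) \<noteq> 0" by auto
    have dp: "degree p = i + 2"
      using IH assms nz by (simp add: p_def degree_mult_eq del: gegenbauer.simps mult_pCons_left)
    have lp: "lead_coeff p > 0"
      using IH assms nz by (simp add: p_def lead_coeff_mult del: gegenbauer.simps mult_pCons_left)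
    have dq: "degree (-q) < degree p"
      using IH degree_smult_le[of "real i + 2 * \<alpha>" "gegenbauer \<alpha> i"] by (simp add: q_def dp)
    have e: "smult (real (i + 2)) (gegenbauer \<alpha> (i + 2)) = p + (- q)"
      unfolding smult_gegenbauer_recurrence p_def q_def by simp
    then have "degree (smult (real (i + 2)) (gegenbauer \<alpha> (i + 2))) = i + 2"
      using degree_add_eq_left[OF dq] dp by simp
    then have d: "degree (gegenbauer \<alpha> (i + 2)) = i + 2" by simp
    have "lead_coeff (smult (real (i + 2)) (gegenbauer \<alpha> (i + 2))) > 0"
      unfolding e using degree_add_eq_left[OF dq] lp dq coeff_eq_0[OF dq] by simp
    then have "real (i + 2) * lead_coeff (gegenbauer \<alpha> (i + 2)) > 0" by (simp only: lead_coeff_smult)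
    then have "lead_coeff (gegenbauer \<alpha> (i + 2)) > 0"
      by (rule zero_less_mult_pos) simp
    then show ?thesis using d j by simp
  qed
qed

section \<open>The largest root\<close>

lemma poly_pos_beyond_roots:
  fixes p :: "real poly"
  assumes "lead_coeff p > 0" and "\<And>s. s \<ge> t \<Longrightarrow> poly p s \<noteq> 0"
  shows "poly p t > 0"
proof (rule ccontr)
  assume "\<not> ?thesis"
  then have neg: "poly p t < 0" using assms(2)[of t] by force
  obtain b where b: "\<forall>x\<ge>b. poly p x \<ge> lead_coeff p"
    using poly_pinfty_gt_lc[OF assms(1)] by blast
  have "poly p (max b (t + 1)) > 0"
    using b assms(1) by (meson less_le_trans max.cobounded1)
  then obtain s where "s > t" "poly p s = 0"
    using poly_IVT_pos[of t "max b (t + 1)" p] neg by (auto simp: less_max_iff_disj)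
  then show False using assms(2)[of s] by simp
qed

lemma
  assumes "\<alpha> > 0" and "{t. poly (gegenbauer \<alpha> j) t = 0} \<noteq> {}"
  shows poly_largest_gegenbauer_root: "poly (gegenbauer \<alpha> j) (largest_gegenbauer_root \<alpha> j) = 0"
    and gegenbauer_root_le: "poly (gegenbauer \<alpha> j) t = 0 \<Longrightarrow> t \<le> largest_gegenbauer_root \<alpha> j"
    and gegenbauer_pos_beyond: "t > largest_gegenbauer_root \<alpha> j \<Longrightarrow> poly (gegenbauer \<alpha> j) t > 0"
proof -
  note lc = gegenbauer_degree_lead_coeff[OF assms(1), of j, THEN conjunct2]
  have nz: "gegenbauer \<alpha> j \<noteq> 0"
    using lc by auto
  have fin: "finite {t. poly (gegenbauer \<alpha> j) t = 0}" by (rule poly_roots_finite[OF nz])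
  show "poly (gegenbauer \<alpha> j) (largest_gegenbauer_root \<alpha> j) = 0"
    using Max_in[OF fin assms(2)] by (simp add: largest_gegenbauer_root_def)
  show le: "t \<le> largest_gegenbauer_root \<alpha> j" if "poly (gegenbauer \<alpha> j) t = 0" for t
    using Max_ge[OF fin] that by (simp add: largest_gegenbauer_root_def)
  show "poly (gegenbauer \<alpha> j) t > 0" if "t > largest_gegenbauer_root \<alpha> j"
    using that le by (intro poly_pos_beyond_roots[OF lc]) force
qed

text \<open>At the largest root of one polynomial the recurrence makes the next polynomial negative,
  so the next one has a still larger root.\<close>
lemma gegenbauer_interlacing:
  assumes "\<alpha> > 0"
  shows "{t. poly (gegenbauer \<alpha> (j + 1)) t = 0} \<noteq> {} \<and>
    (\<forall>i\<le>j. \<forall>t\<ge>largest_gegenbauer_root \<alpha> (j + 1). poly (gegenbauer \<alpha> i) t > 0)"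
proof (induction j)
  case 0
  then show ?case by auto
next
  case (Suc j)
  let ?l = "largest_gegenbauer_root \<alpha> (j + 1)"
  have ne: "{t. poly (gegenbauer \<alpha> (j + 1)) t = 0} \<noteq> {}"
    and pos: "\<And>i t. i \<le> j \<Longrightarrow> t \<ge> ?l \<Longrightarrow> poly (gegenbauer \<alpha> i) t > 0"
    using Suc by auto
  have "real (j + 2) * poly (gegenbauer \<alpha> (j + 2)) ?l = - ((real j + 2 * \<alpha>) * poly (gegenbauer \<alpha> j) ?l)"
    using gegenbauer_recurrence[of j \<alpha> ?l] poly_largest_gegenbauer_root[OF assms ne] by simp
  moreover have "(real j + 2 * \<alpha>) * poly (gegenbauer \<alpha> j) ?l > 0"
    using pos[of j ?l] assms by simp
  ultimately have "real (j + 2) * poly (gegenbauer \<alpha> (j + 2)) ?l < 0" by linarith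
  then have "poly (gegenbauer \<alpha> (j + 2)) ?l < 0"
    by (simp add: mult_less_0_iff del: gegenbauer.simps)
  then obtain s where s: "s \<ge> ?l" "poly (gegenbauer \<alpha> (j + 2)) s = 0"
    using poly_pos_beyond_roots[of "gegenbauer \<alpha> (j + 2)" ?l]
      gegenbauer_degree_lead_coeff[OF assms, of "j + 2"] by force
  have "s \<noteq> ?l" using s \<open>poly (gegenbauer \<alpha> (j + 2)) ?l < 0\<close> by auto
  have ne': "{t. poly (gegenbauer \<alpha> (Suc j + 1)) t = 0} \<noteq> {}" using s by auto
  have less: "?l < largest_gegenbauer_root \<alpha> (Suc j + 1)"
    using gegenbauer_root_le[OF assms ne', of s] s \<open>s \<noteq> ?l\<close> by (simp del: gegenbauer.simps)
  have "poly (gegenbauer \<alpha> i) t > 0" if "i \<le> Suc j" "t \<ge> largest_gegenbauer_root \<alpha> (Suc j + 1)" for i t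
  proof (cases "i \<le> j")
    case True
    then show ?thesis using pos that less by force
  next
    case False
    then show ?thesis using gegenbauer_pos_beyond[OF assms ne, of t] that less
      by (auto simp: le_Suc_eq simp del: gegenbauer.simps)
  qed
  with ne' show ?case by blast
qed

section \<open>Rayleigh quotient bound for the largest root\<close>

text \<open>Passing from \<open>K\<close> to \<open>K + 1\<close> changes the difference of the two
  sides by \<open>e K\<close> times a square over \<open>p K * p (Suc K)\<close>. The boundary term
  makes the induction close. Only \<open>p 0, ..., p K\<close> need to be positive, so
  \<open>p (Suc K) = 0\<close> is allowed, as happens at a root.\<close>

lemma picone_sum:
  fixes p s e v :: "nat \<Rightarrow> real"
  assumes p: "\<And>j. j \<le> K \<Longrightarrow> p j > 0" and e: "\<And>j. e j \<ge> 0"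
    and rec: "\<And>j. j < K \<Longrightarrow> e (Suc j) * p (Suc (Suc j)) + e j * p j = w (Suc j) * p (Suc j)"
    and "v 0 = 0"
  shows "(\<Sum>j<K. w (Suc j) * (v (Suc j))\<^sup>2) \<ge>
    (\<Sum>j<K. 2 * e j * v j * v (Suc j)) + e K * p (Suc K) / p K * (v K)\<^sup>2"
  using p rec
proof (induction K)
  case 0
  then show ?case by (simp add: \<open>v 0 = 0\<close>)
next
  case (Suc K)
  have pos: "p K > 0" "p (Suc K) > 0" using Suc.prems(1) by auto
  have "w (Suc K) = e (Suc K) * p (Suc (Suc K)) / p (Suc K) + e K * p K / p (Suc K)"
    using Suc.prems(2)[of K] pos by (simp add: field_simps)
  then have 1: "w (Suc K) * (v (Suc K))\<^sup>2 = e (Suc K) * p (Suc (Suc K)) / p (Suc K) * (v (Suc K))\<^sup>2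
      + e K * p K / p (Suc K) * (v (Suc K))\<^sup>2"
    by (simp add: algebra_simps)
  have "e K * (p (Suc K) / p K * (v K)\<^sup>2 + p K / p (Suc K) * (v (Suc K))\<^sup>2 - 2 * v K * v (Suc K))
     = e K * ((p (Suc K) * v K - p K * v (Suc K))\<^sup>2 / (p K * p (Suc K)))"
    using pos by (simp add: field_simps power2_eq_square)
  also have "\<dots> \<ge> 0" using e[of K] pos by simp
  finally have "e K * p (Suc K) / p K * (v K)\<^sup>2 + e K * p K / p (Suc K) * (v (Suc K))\<^sup>2
      \<ge> 2 * e K * v K * v (Suc K)"
    by (simp add: algebra_simps)
  with Suc.IH Suc.prems 1 show ?case by simp
qed

text \<open>The weights symmetrising the Gegenbauer recurrence with \<open>2 \<alpha> = N\<close>.\<close>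
definition gegenbauer_weight :: "nat \<Rightarrow> nat \<Rightarrow> real" where
  "gegenbauer_weight N j = fact j / fact (j + N - 1)"

lemma gegenbauer_weight_pos: "gegenbauer_weight N j > 0"
  by (simp add: gegenbauer_weight_def)

text \<open>This is the symmetry: after scaling the recurrence by the weight, the coefficient of
  \<open>p j\<close> in one row, \<open>(j + N) s (j + 1)\<close>, equals
  \<open>e j = (j + 1) s j\<close>, the leading coefficient of the row before.\<close>

lemma gegenbauer_weight_Suc:
  assumes "N \<ge> 1"
  shows "(real j + real N) * gegenbauer_weight N (Suc j) = (real j + 1) * gegenbauer_weight N j"
proof -
  have *: "Suc j + N - 1 = Suc (j + N - 1)" "real (Suc (j + N - 1)) = real j + real N"
    using assms by auto
  show ?thesis
    unfolding gegenbauer_weight_def fact_Suc * using assms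
    by (simp add: divide_simps add_pos_pos *)
qed

lemma gegenbauer_weight_decreasing:
  assumes "N \<ge> 1" "i \<le> j"
  shows "gegenbauer_weight N j \<le> gegenbauer_weight N i"
  using assms(2)
proof (rule lift_Suc_antimono_le[rotated])
  fix n
  have "(real n + real N) * gegenbauer_weight N (Suc n) \<le> (real n + real N) * gegenbauer_weight N n"
    unfolding gegenbauer_weight_Suc[OF assms(1)] using assms gegenbauer_weight_pos[of N n]
    by (intro mult_right_mono) auto
  then show "gegenbauer_weight N (Suc n) \<le> gegenbauer_weight N n"
    using assms by (simp add: mult_le_cancel_left_pos)
qed

text \<open>The weight decays like \<open>j\<close> to the power \<open>-(N - 1)\<close>. Raising
  \<open>N\<close> by one divides it by \<open>j + N\<close>, and
  \<open>(4 q + N) / 4 \<le> q + N\<close> costs one factor 4.\<close>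

lemma gegenbauer_weight_doubling:
  assumes "N \<ge> 1"
  shows "gegenbauer_weight N q \<le> 4 ^ (N - 1) * gegenbauer_weight N (4 * q)"
  using assms
proof (induction N rule: nat_induct_at_least)
  case base
  then show ?case by (simp add: gegenbauer_weight_def)
next
  case (Suc N)
  have step: "gegenbauer_weight (Suc N) i = gegenbauer_weight N i / (real i + real N)" for i
  proof -
    have *: "i + Suc N - 1 = Suc (i + N - 1)" "real (Suc (i + N - 1)) = real i + real N"
      using Suc(1) by auto
    show ?thesis unfolding gegenbauer_weight_def fact_Suc * by simp
  qed
  have pow: "(4::real) ^ (Suc N - 1) = 4 * 4 ^ (N - 1)"
    using Suc(1) by (cases N) auto
  have "gegenbauer_weight (Suc N) q \<le> 4 ^ (N - 1) * gegenbauer_weight N (4 * q) / (real q + real N)"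
    unfolding step using Suc by (intro divide_right_mono) auto
  also have "\<dots> \<le> 4 ^ (N - 1) * gegenbauer_weight N (4 * q) / ((real (4 * q) + real N) / 4)"
    using Suc gegenbauer_weight_pos[of N "4 * q"] by (intro divide_left_mono mult_nonneg_nonneg mult_pos_pos) auto
  also have "\<dots> = 4 ^ (Suc N - 1) * gegenbauer_weight (Suc N) (4 * q)"
    unfolding step pow by simp
  finally show ?case .
qed

lemma sum_symmetric_squares:
  fixes e v :: "nat \<Rightarrow> real"
  assumes "v 0 = 0"
  shows "(\<Sum>j<K. e j * ((v j)\<^sup>2 + (v (Suc j))\<^sup>2)) =
    (\<Sum>j<K. (e j + e (Suc j)) * (v (Suc j))\<^sup>2) - e K * (v K)\<^sup>2"
  by (induction K) (use assms in \<open>simp_all add: algebra_simps\<close>)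

text \<open>By interlacing, the values of \<open>C_0, ..., C_K\<close> at the root \<open>l\<close>
  are positive and solve the symmetrised recurrence, so Picone bounds the sum of
  \<open>2 e j v j v (j + 1)\<close> by \<open>l\<close> times the weighted norm. Writing
  \<open>2 a b = a^2 + b^2 - (a - b)^2\<close> turns this into a bound by differences.\<close>

lemma gegenbauer_root_test_vector:
  fixes v :: "nat \<Rightarrow> real"
  assumes N: "N \<ge> 1" and v: "v 0 = 0" "v K = 0"
  defines "s \<equiv> gegenbauer_weight N"
    and "l \<equiv> largest_gegenbauer_root (real N / 2) (Suc K)"
  shows "(1 - l) * (\<Sum>j<K. (2 * real (Suc j) + real N) * s (Suc j) * (v (Suc j))\<^sup>2)
    \<le> (\<Sum>j<K. (real j + 1) * s j * (v (Suc j) - v j)\<^sup>2)"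
proof -
  let ?\<alpha> = "real N / 2"
  have \<alpha>: "?\<alpha> > 0" using N by simp
  define p where "p j = poly (gegenbauer ?\<alpha> j) l" for j
  define e where "e j = (real j + 1) * s j" for j
  define w where "w j = (2 * real j + real N) * s j" for j
  note il = gegenbauer_interlacing[OF \<alpha>, of K]
  have "(\<Sum>j<K. (l * w (Suc j)) * (v (Suc j))\<^sup>2) \<ge>
    (\<Sum>j<K. 2 * e j * v j * v (Suc j)) + e K * p (Suc K) / p K * (v K)\<^sup>2"
  proof (rule picone_sum)
    show "p j > 0" if "j \<le> K" for j using il that by (simp add: p_def l_def)
    show "e j \<ge> 0" for j using gegenbauer_weight_pos[of N j] by (simp add: e_def s_def)
    show "v 0 = 0" by fact
    show "e (Suc j) * p (Suc (Suc j)) + e j * p j = l * w (Suc j) * p (Suc j)" for j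
    proof -
      have 1: "real (j + 2) * p (j + 2) = 2 * (real j + 1 + ?\<alpha>) * l * p (j + 1) - (real j + real N) * p j"
        using gegenbauer_recurrence[of j ?\<alpha> l] unfolding p_def by (simp del: gegenbauer.simps)
      have 2: "e j = (real j + real N) * s (Suc j)"
        unfolding e_def s_def gegenbauer_weight_Suc[OF N] ..
      have "e (Suc j) * p (Suc (Suc j)) = s (Suc j) * (real (j + 2) * p (j + 2))"
        by (simp add: e_def algebra_simps)
      then show ?thesis unfolding 1 2 w_def by (simp add: algebra_simps)
    qed
  qed
  then have "(\<Sum>j<K. e j * (2 * v j * v (Suc j))) \<le> l * (\<Sum>j<K. w (Suc j) * (v (Suc j))\<^sup>2)"
    by (simp add: v sum_distrib_left mult_ac)
  moreover have "(\<Sum>j<K. e j * (2 * v j * v (Suc j))) =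
      (\<Sum>j<K. e j * ((v j)\<^sup>2 + (v (Suc j))\<^sup>2)) - (\<Sum>j<K. e j * (v (Suc j) - v j)\<^sup>2)"
    by (simp add: sum_subtractf[symmetric] power2_eq_square algebra_simps)
  \<comment> \<open>Constant sequences solve the symmetrised recurrence at \<open>t = 1\<close>;
    this is why exactly \<open>1 - l\<close> remains in front of the norm.\<close>
  moreover have "e j + e (Suc j) = w (Suc j)" for j
  proof -
    have "e j = (real j + real N) * s (Suc j)"
      unfolding e_def s_def gegenbauer_weight_Suc[OF N] ..
    then show ?thesis unfolding w_def by (simp add: e_def algebra_simps)
  qed
  ultimately have "(1 - l) * (\<Sum>j<K. w (Suc j) * (v (Suc j))\<^sup>2) \<le> (\<Sum>j<K. e j * (v (Suc j) - v j)\<^sup>2)"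
    unfolding sum_symmetric_squares[of v e K, OF v(1)] using v by (simp add: algebra_simps)
  then show ?thesis by (simp add: w_def e_def)
qed

lemma largest_gegenbauer_root_lower_bound:
  assumes N: "N \<ge> 1" and q: "q \<ge> 1" "4 * q \<le> K"
  shows "1 - largest_gegenbauer_root (real N / 2) (Suc K) \<le> 27 * 4 ^ (N - 1) / (real q)\<^sup>2"
proof (cases "largest_gegenbauer_root (real N / 2) (Suc K) \<ge> 1")
  \<comment> \<open>Here the claim is trivial. The other case supplies \<open>1 - l \<ge> 0\<close>,
    needed to multiply the lower bound on the norm by it.\<close>
  case True
  then have "1 - largest_gegenbauer_root (real N / 2) (Suc K) \<le> 0" by simp
  also have "0 \<le> 27 * 4 ^ (N - 1) / (real q)\<^sup>2" by simp
  finally show ?thesis .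
next
  case False
  define s where "s = gegenbauer_weight N"
  define l where "l = largest_gegenbauer_root (real N / 2) (Suc K)"
  define r where "r = real q"
  \<comment> \<open>A parabola vanishing at \<open>q\<close> and \<open>4 q\<close>: its slopes are
    of order \<open>q\<close>, its values on the middle third of order \<open>q^2\<close>, and its
    support stays away from 0, so that the weights there are comparable.\<close>
  define v where "v j = (if q \<le> j \<and> j \<le> 4 * q then (real j - r) * (4 * r - real j) else 0)" for j :: nat
  have r: "r \<ge> 1" using q by (simp add: r_def)
  have s: "s j > 0" for j by (simp add: s_def gegenbauer_weight_pos)
  have "v K = 0" using q by (auto simp: v_def r_def)
  have main: "(1 - l) * (\<Sum>j<K. (2 * real (Suc j) + real N) * s (Suc j) * (v (Suc j))\<^sup>2)
    \<le> (\<Sum>j<K. (real j + 1) * s j * (v (Suc j) - v j)\<^sup>2)"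
    unfolding s_def l_def
    by (rule gegenbauer_root_test_vector[OF N]) (use \<open>v K = 0\<close> q in \<open>auto simp: v_def\<close>)
  have "(\<Sum>j<K. (real j + 1) * s j * (v (Suc j) - v j)\<^sup>2)
      = (\<Sum>j\<in>{q..<4*q}. (real j + 1) * s j * (v (Suc j) - v j)\<^sup>2)"
  proof (rule sum.mono_neutral_right)
    show "{q..<4*q} \<subseteq> {..<K}" using q by auto
    have "v (Suc j) = v j" if "j \<notin> {q..<4*q}" for j
    proof -
      have "Suc j < q \<or> Suc j = q \<or> j = 4 * q \<or> j > 4 * q"
        using that unfolding atLeastLessThan_iff by arith
      then show ?thesis by (elim disjE) (auto simp: v_def r_def)
    qed
    then show "\<forall>j\<in>{..<K} - {q..<4*q}. (real j + 1) * s j * (v (Suc j) - v j)\<^sup>2 = 0" by simp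
  qed simp
  \<comment> \<open>There are \<open>3 q\<close> terms, which gives the constant
    \<open>108 = 3 * 4 * 9\<close>.\<close>
  also have "\<dots> \<le> (\<Sum>j\<in>{q..<4*q}. (4 * r) * s q * (3 * r)\<^sup>2)"
  proof (intro sum_mono mult_mono)
    fix j assume j: "j \<in> {q..<4*q}"
    show "real j + 1 \<le> 4 * r" using j by (simp add: r_def)
    show "s j \<le> s q" unfolding s_def using j N by (intro gegenbauer_weight_decreasing) auto
    have "v (Suc j) - v j = (real j + 1 - r) * (4 * r - (real j + 1)) - (real j - r) * (4 * r - real j)"
      using j by (auto simp: v_def add.commute)
    also have "\<dots> = 5 * r - 2 * real j - 1" by (simp add: algebra_simps)
    finally have "\<bar>v (Suc j) - v j\<bar> \<le> 3 * r" using j by (simp add: r_def abs_le_iff)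
    then show "(v (Suc j) - v j)\<^sup>2 \<le> (3 * r)\<^sup>2" using r by (intro abs_le_square_iff[THEN iffD1]) auto
  qed (use r s in \<open>auto simp: less_imp_le\<close>)
  also have "\<dots> = 108 * s q * r ^ 4" by (simp add: r_def algebra_simps power2_eq_square power4_eq_xxxx)
  finally have upper: "(\<Sum>j<K. (real j + 1) * s j * (v (Suc j) - v j)\<^sup>2) \<le> 108 * s q * r ^ 4" .

  \<comment> \<open>Only the \<open>q\<close> indices in \<open>[2 q, 3 q)\<close> are kept; both
    factors of the parabola are at least \<open>q\<close> there. The quotient of the two constants
    is \<open>27 = 108 / 4\<close>.\<close>
  have "4 * s (4 * q) * r ^ 6 = (\<Sum>j\<in>{2*q..<3*q}. (4 * r) * s (4 * q) * (r * r)\<^sup>2)"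
    by (simp add: r_def algebra_simps power2_eq_square eval_nat_numeral)
  also have "\<dots> \<le> (\<Sum>j\<in>{2*q..<3*q}. (2 * real j + real N) * s j * (v j)\<^sup>2)"
  proof (intro sum_mono mult_mono)
    fix j assume j: "j \<in> {2*q..<3*q}"
    show "4 * r \<le> 2 * real j + real N" using j by (simp add: r_def)
    show "s (4 * q) \<le> s j" unfolding s_def using j N by (intro gegenbauer_weight_decreasing) auto
    have "r * r \<le> (real j - r) * (4 * r - real j)"
      using j r by (intro mult_mono) (auto simp: r_def)
    also have "\<dots> = v j" using j by (auto simp: v_def)
    finally show "(r * r)\<^sup>2 \<le> (v j)\<^sup>2" using r by (intro power_mono) auto
  qed (use s in \<open>auto simp: less_imp_le\<close>)
  also have "\<dots> \<le> (\<Sum>j\<in>{1..K}. (2 * real j + real N) * s j * (v j)\<^sup>2)"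
    by (rule sum_mono2) (use q s in \<open>auto simp: less_imp_le\<close>)
  also have "\<dots> = (\<Sum>j<K. (2 * real (Suc j) + real N) * s (Suc j) * (v (Suc j))\<^sup>2)"
    by (simp only: sum.atLeast1_atMost_eq One_nat_def)
  finally have "(1 - l) * (4 * s (4 * q) * r ^ 6) \<le>
      (1 - l) * (\<Sum>j<K. (2 * real (Suc j) + real N) * s (Suc j) * (v (Suc j))\<^sup>2)"
    using False by (intro mult_left_mono) (auto simp: l_def)
  also note main
  also note upper
  also have "108 * s q * r ^ 4 \<le> 108 * (4 ^ (N - 1) * s (4 * q)) * r ^ 4"
    unfolding s_def using gegenbauer_weight_doubling[OF N, of q] by (intro mult_right_mono mult_left_mono) auto
  finally have "(4 * s (4 * q) * r ^ 4) * ((1 - l) * r\<^sup>2) \<le> (4 * s (4 * q) * r ^ 4) * (27 * 4 ^ (N - 1))"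
    by (simp add: algebra_simps eval_nat_numeral)
  then have "(1 - l) * r\<^sup>2 \<le> 27 * 4 ^ (N - 1)"
    by (rule mult_left_le_imp_le) (use s[of "4 * q"] r in auto)
  then show ?thesis using r by (simp add: l_def r_def pos_le_divide_eq)
qed

section \<open>Moments of the surface measure\<close>

text \<open>Both translation-invariant measures are compared on the unit ball \<open>B\<close>, which \<open>T\<close> preserves:
  Fubini gives \<open>|B| |T\<^sup>-\<^sup>1 A| = |B| |A|\<close>.\<close>
lemma distr_lborel_orthogonal_transformation:
  fixes T :: "'a::euclidean_space \<Rightarrow> 'a"
  assumes "orthogonal_transformation T"
  shows "distr lborel borel T = lborel"
proof (rule measure_eqI)
  have lin: "linear T" and norm_T: "\<And>x. norm (T x) = norm x"
    using assms by (auto simp: orthogonal_transformation_norm orthogonal_transformation_linear)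
  interpret linear T by fact
  have bl: "bounded_linear T" using lin by (simp add: linear_linear)
  have T[measurable]: "T \<in> borel_measurable borel"
    using linear_continuous_on[OF bl] by (rule borel_measurable_continuous_onI)
  show "sets (distr lborel borel T) = sets lborel" by simp
  fix A :: "'a set" assume "A \<in> sets (distr lborel borel T)"
  then have [measurable]: "A \<in> sets borel" by simp
  define B :: "'a set" where "B = ball 0 1"
  have [measurable]: "B \<in> sets borel" by (simp add: B_def)
  have TB: "indicator B (T y) = (indicator B y :: ennreal)" for y
    by (auto simp: B_def indicator_def norm_T)
  have translate: "(\<integral>\<^sup>+ x. f (c + x) \<partial>lborel) = (\<integral>\<^sup>+ x. f x \<partial>lborel)"
    if [measurable]: "f \<in> borel_measurable borel" for f :: "'a \<Rightarrow> ennreal" and c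
    by (subst (2) lborel_distr_plus[symmetric, of c]) (simp add: nn_integral_distr)
  have reflect: "(\<integral>\<^sup>+ x. f (c - x) \<partial>lborel) = (\<integral>\<^sup>+ x. f x \<partial>lborel)"
    if [measurable]: "f \<in> borel_measurable borel" for f :: "'a \<Rightarrow> ennreal" and c
    by (subst (2) lborel_affine[of "-1" c]) (simp_all add: nn_integral_distr density_1)
  let ?a = "emeasure (distr lborel borel T) A"
  have a: "?a = (\<integral>\<^sup>+ y. indicator A (T y) \<partial>lborel)"
    by (simp add: nn_integral_indicator[symmetric] nn_integral_distr del: nn_integral_indicator)
  have "emeasure lborel B * ?a = (\<integral>\<^sup>+ y. emeasure lborel B * indicator A (T y) \<partial>lborel)"
    unfolding a by (simp add: nn_integral_cmult)
  also have "\<dots> = (\<integral>\<^sup>+ y. (\<integral>\<^sup>+ x. indicator B (T y + x) * indicator A (T y) \<partial>lborel) \<partial>lborel)"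
    by (intro nn_integral_cong)
      (simp add: nn_integral_multc translate[of "indicator B"])
  also have "\<dots> = (\<integral>\<^sup>+ x. (\<integral>\<^sup>+ y. indicator B (T y + x) * indicator A (T y) \<partial>lborel) \<partial>lborel)"
    by (rule lborel_pair.Fubini') measurable
  also have "\<dots> = (\<integral>\<^sup>+ x. (\<integral>\<^sup>+ y. indicator B (T y) * indicator A (T y - x) \<partial>lborel) \<partial>lborel)"
  proof (rule nn_integral_cong)
    \<comment> \<open>Surjectivity turns the shift by \<open>x\<close> after \<open>T\<close> into a
      shift by \<open>z\<close> before \<open>T\<close>, under which Lebesgue measure is
      invariant.\<close>
    fix x
    obtain z where z: "T z = x"
      using orthogonal_transformation_surj[OF assms] by (metis surjD)
    show "(\<integral>\<^sup>+ y. indicator B (T y + x) * indicator A (T y) \<partial>lborel) =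
      (\<integral>\<^sup>+ y. indicator B (T y) * indicator A (T y - x) \<partial>lborel)"
      using translate[of "\<lambda>y. indicator B (T y) * indicator A (T y - x)" z]
      by (simp add: add z add.commute)
  qed
  also have "\<dots> = (\<integral>\<^sup>+ y. (\<integral>\<^sup>+ x. indicator B (T y) * indicator A (T y - x) \<partial>lborel) \<partial>lborel)"
    by (rule lborel_pair.Fubini') measurable
  also have "\<dots> = (\<integral>\<^sup>+ y. indicator B y * emeasure lborel A \<partial>lborel)"
    by (intro nn_integral_cong) (simp add: nn_integral_cmult reflect[of "indicator A"] TB)
  also have "\<dots> = emeasure lborel B * emeasure lborel A"
    by (simp add: nn_integral_multc)
  finally have "emeasure lborel B * ?a = emeasure lborel B * emeasure lborel A" .
  moreover have "emeasure lborel B \<noteq> \<infinity>"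
    unfolding B_def using emeasure_lborel_ball_finite[of "0::'a" 1] by auto
  moreover have "emeasure lborel B \<noteq> 0"
    unfolding B_def using open_not_negligible[of "ball (0::'a) 1"]
    by (auto simp: negligible_iff_emeasure0)
  ultimately show "?a = emeasure lborel A"
    by (simp add: ennreal_mult_cancel_left)
qed

section \<open>Integration on the sphere and rotation invariance\<close>

lemma finite_measure_sphere_measure: "finite_measure (sphere_measure :: (real ^ 'n) measure)"
proof (rule finite_measureI)
  have "emeasure lborel {r *\<^sub>R x |r x. 0 < r \<and> r \<le> 1 \<and> x \<in> (unit_sphere :: (real ^ 'n) set)}
     \<le> emeasure lborel (cball (0 :: real ^ 'n) 1)"
    by (rule emeasure_mono) auto
  also have "\<dots> < \<infinity>" by (rule emeasure_lborel_cball_finite)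
  finally show "emeasure sphere_measure (space (sphere_measure :: (real ^ 'n) measure)) \<noteq> \<infinity>"
    by (simp add: emeasure_sphere_measure ennreal_mult_eq_top_iff)
qed

lemma measurable_sphere_measure:
  fixes g :: "real ^ 'n \<Rightarrow> real"
  assumes "continuous_on unit_sphere g"
  shows "g \<in> borel_measurable sphere_measure"
  using borel_measurable_continuous_on_restrict[OF assms]
  by (simp add: measurable_cong_sets[OF sets_sphere_measure refl])

lemma integrable_sphere_measure:
  fixes g :: "real ^ 'n \<Rightarrow> real"
  assumes "continuous_on unit_sphere g"
  shows "integrable sphere_measure g"
proof -
  obtain b where b: "\<forall>x\<in>unit_sphere. norm (g x) \<le> b"
    using compact_imp_bounded[OF compact_continuous_image[OF assms compact_sphere]]
    unfolding bounded_iff by blast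
  interpret finite_measure "sphere_measure :: (real ^ 'n) measure"
    by (rule finite_measure_sphere_measure)
  show ?thesis
    by (rule integrable_const_bound[of _ b]) (use b in \<open>auto intro: measurable_sphere_measure assms\<close>)
qed

text \<open>As a constant density, the scaling factor is open to the density rules for integrals and
  for almost-everywhere statements.\<close>

lemma sphere_measure_eq_density:
  "(sphere_measure :: (real ^ 'n) measure) =
     density (distr (restrict_space lborel (cball 0 1 - {0})) (restrict_space borel unit_sphere)
         (\<lambda>x. x /\<^sub>R norm x)) (\<lambda>_. ennreal (real CARD('n)))"
  unfolding sphere_measure_def
  by (rule measure_eqI) (simp_all add: emeasure_density_const ennreal_of_nat_eq_real_of_nat)

lemma integral_sphere_measure:
  fixes g :: "real ^ 'n \<Rightarrow> real"
  assumes "continuous_on UNIV g"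
  shows "integral\<^sup>L sphere_measure g =
    real CARD('n) * (\<integral>x. indicator (cball 0 1 - {0}) x * g (x /\<^sub>R norm x) \<partial>lborel)"
proof -
  let ?M = "distr (restrict_space lborel (cball 0 1 - {0})) (restrict_space borel unit_sphere)
         (\<lambda>x. x /\<^sub>R norm x) :: (real ^ 'n) measure"
  have g: "g \<in> borel_measurable (restrict_space borel unit_sphere)"
    using assms by (intro borel_measurable_continuous_on_restrict) (auto intro: continuous_on_subset)
  have "integral\<^sup>L sphere_measure g = integral\<^sup>L ?M (\<lambda>x. real CARD('n) *\<^sub>R g x)"
    unfolding sphere_measure_eq_density by (rule integral_density) (use g in auto)
  also have "\<dots> = real CARD('n) * integral\<^sup>L ?M g" by simp
  also have "integral\<^sup>L ?M g = (\<integral>x. g (x /\<^sub>R norm x) \<partial>restrict_space lborel (cball 0 1 - {0}))"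
    by (rule integral_distr[OF radial_projection_measurable g])
  also have "\<dots> = (\<integral>x. indicator (cball 0 1 - {0}) x * g (x /\<^sub>R norm x) \<partial>lborel)"
    by (subst integral_restrict_space) auto
  finally show ?thesis .
qed

text \<open>An orthogonal map taking \<open>x\<close> to \<open>z\<close> preserves Lebesgue
  measure, the punctured ball and the inner product. Equal norms suffice, and the mixed moments
  below use vectors that are not of unit length.\<close>

lemma integral_sphere_zonal:
  fixes x z :: "real ^ 'n" and \<phi> :: "real \<Rightarrow> real"
  assumes "norm x = norm z" and \<phi>: "continuous_on UNIV \<phi>"
  shows "(LINT y|sphere_measure. \<phi> (x \<bullet> y)) = (LINT y|sphere_measure. \<phi> (z \<bullet> y))"
proof -
  obtain T where T: "orthogonal_transformation T" "T x = z"
    using orthogonal_transformation_exists[OF assms(1)] .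
  have norm_T: "norm (T y) = norm y" and scale: "T (c *\<^sub>R y) = c *\<^sub>R T y"
    and inner_T: "T v \<bullet> T y = v \<bullet> y" for c v y
    using T(1) by (auto simp: orthogonal_transformation_norm orthogonal_transformation_def linear_scale)
  have "bounded_linear T" using orthogonal_transformation_linear[OF T(1)] by (simp add: linear_linear)
  then have [measurable]: "T \<in> borel_measurable borel"
    by (intro borel_measurable_continuous_onI linear_continuous_on)
  have [measurable]: "\<phi> \<in> borel_measurable borel"
    using \<phi> by (rule borel_measurable_continuous_onI)
  have cont: "continuous_on UNIV (\<lambda>y. \<phi> (v \<bullet> y))" for v :: "real ^ 'n"
    by (intro continuous_on_compose2[OF \<phi>] continuous_intros) auto
  have [measurable]: "cball 0 1 - {0 :: real ^ 'n} \<in> sets borel" by simp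
  have eq: "indicator (cball 0 1 - {0}) (T y) * \<phi> (z \<bullet> (T y /\<^sub>R norm (T y)))
      = (indicator (cball 0 1 - {0}) y * \<phi> (x \<bullet> (y /\<^sub>R norm y)) :: real)" for y
  proof -
    have "z \<bullet> T y = x \<bullet> y" using inner_T[of x y] T(2) by metis
    then have "z \<bullet> (T y /\<^sub>R norm (T y)) = x \<bullet> (y /\<^sub>R norm y)"
      by (simp add: norm_T)
    moreover have "indicator (cball 0 1 - {0}) (T y) = (indicator (cball 0 1 - {0}) y :: real)"
    proof -
      have "T y = 0 \<longleftrightarrow> y = 0" using norm_T[of y] by (metis norm_eq_zero)
      then show ?thesis by (simp add: indicator_def norm_T)
    qed
    ultimately show ?thesis by simp
  qed
  have "(\<integral>y. indicator (cball 0 1 - {0}) y * \<phi> (z \<bullet> (y /\<^sub>R norm y)) \<partial>lborel)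
    = (\<integral>y. indicator (cball 0 1 - {0}) y * \<phi> (z \<bullet> (y /\<^sub>R norm y)) \<partial>distr lborel borel T)"
    by (simp only: distr_lborel_orthogonal_transformation[OF T(1)])
  also have "\<dots> = (\<integral>y. indicator (cball 0 1 - {0}) y * \<phi> (x \<bullet> (y /\<^sub>R norm y)) \<partial>lborel)"
    using integral_distr[of T lborel borel "\<lambda>y. indicator (cball 0 1 - {0}) y * \<phi> (z \<bullet> (y /\<^sub>R norm y)) :: real"]
    unfolding eq by simp
  finally show ?thesis by (simp only: integral_sphere_measure[OF cont])
qed

lemma continuous_on_poly_inner:
  fixes x :: "real ^ 'n"
  shows "continuous_on S (\<lambda>y. poly p (x \<bullet> y))"
  by (intro continuous_intros)

lemma integrable_sphere_power:
  fixes x z :: "real ^ 'n"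
  shows "integrable sphere_measure (\<lambda>y. (x \<bullet> y) ^ i * (z \<bullet> y) ^ j)"
  by (intro integrable_sphere_measure continuous_intros)

lemma sphere_odd_moment:
  fixes x :: "real ^ 'n"
  assumes "odd i"
  shows "(LINT y|sphere_measure. (x \<bullet> y) ^ i) = 0"
proof -
  have "(LINT y|sphere_measure. (x \<bullet> y) ^ i) = (LINT y|sphere_measure. ((- x) \<bullet> y) ^ i)"
    by (rule integral_sphere_zonal) (auto intro: continuous_intros)
  then show ?thesis using assms by simp
qed

text \<open>By rotation invariance the integral of \<open>((a + s b) \<bullet> y) ^ (2 p)\<close> is a multiple of
  \<open>(1 + s\<^sup>2) ^ p\<close>; compare the coefficients of \<open>s\<^sup>2\<close>.\<close>
lemma sphere_mixed_moment:
  fixes a b :: "real ^ 'n"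
  assumes ab: "norm a = 1" "norm b = 1" "a \<bullet> b = 0"
  shows "(2 * real p + 1) * (LINT y|sphere_measure. (b \<bullet> y)\<^sup>2 * (a \<bullet> y) ^ (2 * p))
    = (LINT y|sphere_measure. (a \<bullet> y) ^ (2 * (p + 1)))"
proof -
  define n where "n = 2 * (p + 1)"
  define m where "m = (LINT y|sphere_measure. (a \<bullet> y) ^ n)"
  define A where "A k = (LINT y|sphere_measure. (b \<bullet> y) ^ k * (a \<bullet> y) ^ (n - k))" for k
  define P where "P = (\<Sum>k\<le>n. monom (real (n choose k) * A k) k)"
  define Q where "Q = (\<Sum>k\<le>p + 1. monom (real ((p + 1) choose k) * m) (2 * k))"
  have "poly P s = poly Q s" for s
  proof -
    have "(norm (s *\<^sub>R b + a))\<^sup>2 = (norm (sqrt (1 + s\<^sup>2) *\<^sub>R a))\<^sup>2"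
    proof -
      have "a \<bullet> a = 1" "b \<bullet> b = 1" using ab by (simp_all add: norm_eq_1)
      moreover have "(sqrt (1 + s\<^sup>2))\<^sup>2 = 1 + s\<^sup>2" by simp
      ultimately show ?thesis
        using ab(3) unfolding power2_norm_eq_inner inner_add_left inner_add_right
        by (simp add: inner_commute power2_eq_square)
    qed
    then have nrm: "norm (s *\<^sub>R b + a) = norm (sqrt (1 + s\<^sup>2) *\<^sub>R a)"
      by (simp only: power2_eq_iff_nonneg norm_ge_zero)
    have coeff: "real (n choose k) * A k * s ^ k =
        (LINT y|sphere_measure. (real (n choose k) * s ^ k) * ((b \<bullet> y) ^ k * (a \<bullet> y) ^ (n - k)))" for k
      unfolding integral_mult_right_zero A_def[symmetric] by (simp only: mult_ac)
    have "poly P s = (\<Sum>k\<le>n. LINT y|sphere_measure. (real (n choose k) * s ^ k) * ((b \<bullet> y) ^ k * (a \<bullet> y) ^ (n - k)))"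
      unfolding P_def poly_sum poly_monom coeff ..
    also have "\<dots> = (LINT y|sphere_measure. (\<Sum>k\<le>n. (real (n choose k) * s ^ k) * ((b \<bullet> y) ^ k * (a \<bullet> y) ^ (n - k))))"
      by (rule Bochner_Integration.integral_sum[symmetric])
        (intro integrable_mult_right integrable_sphere_power)
    also have "\<dots> = (LINT y|sphere_measure. ((s *\<^sub>R b + a) \<bullet> y) ^ n)"
      unfolding inner_add_left inner_scaleR_left binomial_ring power_mult_distrib
      by (simp only: mult.assoc)
    also have "\<dots> = (LINT y|sphere_measure. ((sqrt (1 + s\<^sup>2) *\<^sub>R a) \<bullet> y) ^ n)"
      by (rule integral_sphere_zonal[OF nrm]) (intro continuous_intros)
    also have "\<dots> = sqrt (1 + s\<^sup>2) ^ n * m"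
      by (simp only: inner_scaleR_left power_mult_distrib integral_mult_right_zero m_def)
    also have "sqrt (1 + s\<^sup>2) ^ n = (s\<^sup>2 + 1) ^ (p + 1)"
    proof -
      have "(sqrt (1 + s\<^sup>2))\<^sup>2 = s\<^sup>2 + 1" by simp
      then show ?thesis unfolding n_def power_mult by (simp only:)
    qed
    also have "(s\<^sup>2 + 1) ^ (p + 1) * m = poly Q s"
      unfolding binomial_ring Q_def poly_sum poly_monom sum_distrib_right power_mult power_one
      by (rule sum.cong) auto
    finally show ?thesis .
  qed
  then have "P = Q" by (simp add: poly_eq_poly_eq_iff[symmetric] ext)
  then have "coeff P 2 = coeff Q 2" by (rule arg_cong)
  moreover have "coeff P 2 = real (n choose 2) * A 2"
  proof -
    have "coeff P 2 = (\<Sum>k\<le>n. if k = 2 then real (n choose 2) * A 2 else 0)"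
      unfolding P_def coeff_sum by (rule sum.cong) (auto simp: coeff_monom)
    also have "\<dots> = real (n choose 2) * A 2"
      using n_def by (subst sum.delta) auto
    finally show ?thesis .
  qed
  moreover have "coeff Q 2 = real (p + 1) * m"
  proof -
    have "coeff Q 2 = (\<Sum>k\<le>p + 1. if k = 1 then real ((p + 1) choose 1) * m else 0)"
      unfolding Q_def coeff_sum by (rule sum.cong) (auto simp: coeff_monom)
    also have "\<dots> = real (p + 1) * m"
      by (subst sum.delta) auto
    finally show ?thesis .
  qed
  \<comment> \<open>The factor \<open>p + 1\<close> occurs in the coefficients of both
    \<open>P\<close> and \<open>Q\<close> and cancels.\<close>
  moreover have "real (n choose 2) = real (p + 1) * (2 * real p + 1)"
  proof -
    have "n choose 2 = (p + 1) * (2 * p + 1)"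
      unfolding choose_two n_def by simp
    then show ?thesis by (simp only: of_nat_mult of_nat_add of_nat_1 of_nat_numeral)
  qed
  ultimately have "real (p + 1) * ((2 * real p + 1) * A 2) = real (p + 1) * m"
    by (simp only: mult.assoc)
  then have "(2 * real p + 1) * A 2 = m" by (simp only: mult_cancel_left) simp
  moreover have "n - 2 = 2 * p" by (simp add: n_def)
  ultimately show ?thesis unfolding A_def m_def n_def by simp
qed

text \<open>For odd \<open>i\<close> both sides vanish. For even \<open>i\<close>, insert
  \<open>1\<close>, the sum of the squared coordinates, into the moment along an axis: that axis
  contributes the moment of order \<open>i + 2\<close>, each of the other \<open>n - 1\<close> axes
  the same divided by \<open>i + 1\<close>.\<close>

lemma sphere_moment_recurrence:
  fixes x :: "real ^ 'n"
  assumes "norm x = 1"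
  shows "(real i + real CARD('n)) * (LINT y|sphere_measure. (x \<bullet> y) ^ (i + 2))
    = (real i + 1) * (LINT y|sphere_measure. (x \<bullet> y) ^ i)"
proof (cases "even i")
  case False
  then have "odd (i + 2)" by simp
  with False show ?thesis by (simp only: sphere_odd_moment not_False_eq_True mult_zero_right)
next
  case True
  then obtain p where i: "i = 2 * p" by (elim evenE)
  fix k :: 'n
  define a :: "real ^ 'n" where "a = axis k 1"
  define m where "m j = (LINT y|sphere_measure. (x \<bullet> y) ^ j)" for j
  have m: "(LINT y|sphere_measure. (v \<bullet> y) ^ j) = m j" if "norm v = 1" for j and v :: "real ^ 'n"
    unfolding m_def by (rule integral_sphere_zonal) (use assms that in \<open>auto intro: continuous_intros\<close>)
  have a: "norm a = 1" by (simp add: a_def)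
  have mixed: "(LINT y|sphere_measure. (axis b 1 \<bullet> y)\<^sup>2 * (a \<bullet> y) ^ i) =
      (if b = k then m (i + 2) else m (i + 2) / (real i + 1))" for b
  proof (cases "b = k")
    case True
    then show ?thesis using m[OF a, of "i + 2"] by (simp add: a_def power_add mult.commute power2_eq_square mult.left_commute)
  next
    case False
    have "(real i + 1) * (LINT y|sphere_measure. (axis b 1 \<bullet> y)\<^sup>2 * (a \<bullet> y) ^ i) = m (i + 2)"
      using sphere_mixed_moment[of a "axis b 1" p] a False m[OF a, of "i + 2"]
      by (simp add: i a_def inner_axis_axis)
    then show ?thesis using False by (simp add: field_simps)
  qed
  have "m i = (LINT y|sphere_measure. (\<Sum>b\<in>UNIV. (axis b 1 \<bullet> y)\<^sup>2 * (a \<bullet> y) ^ i))"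
    unfolding m[OF a, symmetric]
  proof (rule Bochner_Integration.integral_cong)
    fix y :: "real ^ 'n" assume "y \<in> space sphere_measure"
    then have "y \<bullet> y = 1" by (simp add: norm_eq_1)
    then have "(\<Sum>b\<in>UNIV. (axis b 1 \<bullet> y)\<^sup>2) = 1"
      by (simp add: inner_vec_def[of y y] inner_axis' power2_eq_square)
    then show "(a \<bullet> y) ^ i = (\<Sum>b\<in>UNIV. (axis b 1 \<bullet> y)\<^sup>2 * (a \<bullet> y) ^ i)"
      by (simp add: sum_distrib_right[symmetric])
  qed simp
  also have "\<dots> = (\<Sum>b\<in>UNIV. (LINT y|sphere_measure. (axis b 1 \<bullet> y)\<^sup>2 * (a \<bullet> y) ^ i))"
    by (rule Bochner_Integration.integral_sum) (rule integrable_sphere_power)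
  also have "\<dots> = (\<Sum>b\<in>UNIV. if b = k then m (i + 2) else m (i + 2) / (real i + 1))"
    by (simp only: mixed)
  also have "\<dots> = m (i + 2) + (real CARD('n) - 1) * (m (i + 2) / (real i + 1))"
    by (subst sum.remove[of _ k]) (auto simp: of_nat_diff)
  finally show ?thesis unfolding m_def[symmetric] by (simp add: field_simps)
qed

section \<open>Orthogonality and the kernel\<close>

text \<open>Favard's argument: a functional vanishing on all \<open>C\<^sub>j\<close> with \<open>j \<ge> 1\<close> makes the family
  orthogonal, by the three-term recurrence.\<close>
lemma gegenbauer_orthogonal:
  fixes L :: "real poly \<Rightarrow> real"
  assumes add: "\<And>p q. L (p + q) = L p + L q" and smult: "\<And>c p. L (smult c p) = c * L p"
    and "\<alpha> > 0"
    and zero: "\<And>j. L (gegenbauer \<alpha> (j + 1)) = 0"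
    and "degree p < m"
  shows "L (gegenbauer \<alpha> m * p) = 0"
  using \<open>degree p < m\<close>
proof (induction p arbitrary: m rule: pCons_induct)
  case 0
  then show ?case using smult[of 0 0] by simp
next
  case (pCons a p)
  obtain i where m: "m = i + 1" using pCons.prems by (cases m) auto
  have diff: "L (p - q) = L p - L q" for p q
    using add[of p "smult (-1) q"] smult[of "-1" q] by simp
  \<comment> \<open>The recurrence expresses \<open>t C_m p\<close> through \<open>C_(m+1) p\<close>
    and \<open>C_(m-1) p\<close>, and the degree of \<open>p\<close> is below both indices.
    \<open>p = 0\<close> is separate, since then \<open>pCons a p\<close> has no larger degree than
    \<open>p\<close>.\<close>
  have "L ([:0, 1:] * gegenbauer \<alpha> m * p) = 0"
  proof (cases "p = 0")
    case True
    then show ?thesis using smult[of 0 0] by simp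
  next
    case False
    then have deg: "degree p < i" using pCons.prems m by simp
    have "smult (real (i + 2)) (gegenbauer \<alpha> (i + 2)) * p =
      smult (2 * (real i + 1 + \<alpha>)) ([:0, 1:] * gegenbauer \<alpha> (i + 1)) * p
       - smult (real i + 2 * \<alpha>) (gegenbauer \<alpha> i) * p"
      unfolding smult_gegenbauer_recurrence by (rule left_diff_distrib)
    then have "L (smult (real (i + 2)) (gegenbauer \<alpha> (i + 2) * p)) =
      L (smult (2 * (real i + 1 + \<alpha>)) ([:0, 1:] * gegenbauer \<alpha> (i + 1) * p)
       - smult (real i + 2 * \<alpha>) (gegenbauer \<alpha> i * p))"
      by (simp only: mult_smult_left)
    then have "2 * (real i + 1 + \<alpha>) * L ([:0, 1:] * gegenbauer \<alpha> (i + 1) * p) =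
      real (i + 2) * L (gegenbauer \<alpha> (i + 2) * p) + (real i + 2 * \<alpha>) * L (gegenbauer \<alpha> i * p)"
      by (simp only: diff smult)
    also have "\<dots> = 0"
      using pCons.IH[of "i + 2"] pCons.IH[of i] deg by (simp del: gegenbauer.simps)
    finally show ?thesis using \<open>\<alpha> > 0\<close> by (simp add: m add_eq_0_iff del: gegenbauer.simps)
  qed
  moreover have "gegenbauer \<alpha> m * pCons a p = smult a (gegenbauer \<alpha> m) + [:0, 1:] * gegenbauer \<alpha> m * p"
    by (simp add: mult_pCons_right)
  ultimately show ?case
    unfolding m using zero[of i] by (simp only: add smult mult_zero_right add_0_left)
qed

text \<open>For unit \<open>x\<close> and \<open>n \<ge> 2\<close> this is, up to a constant factor,
  integration against \<open>(1 - t^2)\<close> to the power \<open>(n - 3) / 2\<close> on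
  \<open>[-1, 1]\<close>, treated as a linear functional on polynomials.\<close>

definition zonal_integral :: "real ^ 'n \<Rightarrow> real poly \<Rightarrow> real" where
  "zonal_integral x p = (LINT y|sphere_measure. poly p (x \<bullet> y))"

lemma integrable_zonal:
  fixes x :: "real ^ 'n"
  shows "integrable sphere_measure (\<lambda>y. poly p (x \<bullet> y))"
  by (intro integrable_sphere_measure continuous_on_poly_inner)

lemma zonal_integral_add: "zonal_integral x (p + q) = zonal_integral x p + zonal_integral x q"
  unfolding zonal_integral_def poly_add
  by (rule Bochner_Integration.integral_add) (rule integrable_zonal)+

lemma zonal_integral_smult: "zonal_integral x (smult c p) = c * zonal_integral x p"
  unfolding zonal_integral_def poly_smult by (rule integral_mult_right_zero)

lemma zonal_integral_diff: "zonal_integral x (p - q) = zonal_integral x p - zonal_integral x q"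
  using zonal_integral_add[of x p "smult (-1) q"] zonal_integral_smult[of x "-1" q] by simp

lemma zonal_integral_rotate:
  fixes x z :: "real ^ 'n"
  assumes "norm x = norm z"
  shows "zonal_integral x p = zonal_integral z p"
  unfolding zonal_integral_def
  by (rule integral_sphere_zonal[OF assms, where \<phi> = "poly p"]) (intro continuous_intros)

text \<open>By linearity it suffices to check monomials. For positive exponents the claim is the
  moment recurrence; for constants it is the vanishing of the first moment.\<close>

lemma zonal_integral_by_parts:
  fixes x :: "real ^ 'n"
  assumes "norm x = 1"
  shows "zonal_integral x ([:1, 0, -1:] * pderiv q - smult (real CARD('n) - 1) ([:0, 1:] * q)) = 0"
proof -
  define Z where "Z q = zonal_integral x ([:1, 0, -1:] * pderiv q - smult (real CARD('n) - 1) ([:0, 1:] * q))" for q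
  define m where "m i = zonal_integral x (monom 1 i)" for i
  have Z_add: "Z (p + q) = Z p + Z q" for p q
  proof -
    have "[:1, 0, -1:] * pderiv (p + q) - smult (real CARD('n) - 1) ([:0, 1:] * (p + q)) =
     ([:1, 0, -1:] * pderiv p - smult (real CARD('n) - 1) ([:0, 1:] * p)) +
     ([:1, 0, -1:] * pderiv q - smult (real CARD('n) - 1) ([:0, 1:] * q))"
      unfolding pderiv_add distrib_left smult_add_right by (rule add_diff_add)
    then show ?thesis by (simp only: Z_def zonal_integral_add)
  qed
  have m_rec: "(real i + real CARD('n)) * m (i + 2) = (real i + 1) * m i" for i
    using sphere_moment_recurrence[OF assms, of i] by (simp add: m_def zonal_integral_def poly_monom)
  have Z_monom: "Z (monom c i) = 0" for c i
  proof (cases i)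
    case 0
    have "[:1, 0, -1:] * pderiv (monom c i) - smult (real CARD('n) - 1) ([:0, 1:] * monom c i)
       = smult (- (real CARD('n) - 1) * c) (monom 1 1)"
      by (simp add: 0 pderiv_monom monom_altdef algebra_simps)
    moreover have "m 1 = 0"
      using sphere_odd_moment[of 1 x] by (simp add: m_def zonal_integral_def poly_monom)
    ultimately show ?thesis by (simp only: Z_def zonal_integral_smult m_def mult_zero_right)
  next
    case (Suc j)
    have "poly ([:1, 0, -1:] * pderiv (monom c i) - smult (real CARD('n) - 1) ([:0, 1:] * monom c i)) t
       = poly (smult (real i * c) (monom 1 j) - smult ((real j + real CARD('n)) * c) (monom 1 (j + 2))) t" for t
      by (simp add: Suc pderiv_monom poly_monom algebra_simps)
    then have "[:1, 0, -1:] * pderiv (monom c i) - smult (real CARD('n) - 1) ([:0, 1:] * monom c i)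
       = smult (real i * c) (monom 1 j) - smult ((real j + real CARD('n)) * c) (monom 1 (j + 2))"
      by (simp only: poly_eq_poly_eq_iff[symmetric]) (rule ext)
    then have "Z (monom c i) = real i * c * m j - (real j + real CARD('n)) * c * m (j + 2)"
      by (simp only: Z_def zonal_integral_smult zonal_integral_diff m_def)
    also have "\<dots> = c * ((real j + 1) * m j - (real j + real CARD('n)) * m (j + 2))"
      by (simp add: Suc algebra_simps)
    finally show ?thesis unfolding m_rec by simp
  qed
  have "Z (\<Sum>i\<le>k. monom (coeff q i) i) = 0" for k
    by (induction k) (simp_all add: Z_monom Z_add)
  then have "Z q = 0" using poly_as_sum_of_monoms[of q] by metis
  then show ?thesis by (simp only: Z_def)
qed

text \<open>Integration by parts with \<open>q\<close> the derivative of \<open>C_(j+1)\<close> and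
  \<open>2 \<alpha> + 1 = n - 1\<close> gives the left side of the differential equation. Hence a
  nonzero eigenvalue times the mean of \<open>C_(j+1)\<close> is zero, and Favard's argument
  applies.\<close>

lemma zonal_integral_gegenbauer:
  fixes x :: "real ^ 'n"
  assumes "norm x = 1" "CARD('n) \<ge> 3" "degree p < m"
  shows "zonal_integral x (gegenbauer ((real CARD('n) - 2) / 2) m * p) = 0"
proof (rule gegenbauer_orthogonal)
  let ?\<alpha> = "(real CARD('n) - 2) / 2"
  show "?\<alpha> > 0" using assms by simp
  show "zonal_integral x (gegenbauer ?\<alpha> (j + 1)) = 0" for j
  proof -
    have "2 * ?\<alpha> + 1 = real CARD('n) - 1" by (simp add: field_simps)
    then have "- (real (j + 1) * (real (j + 1) + 2 * ?\<alpha>)) * zonal_integral x (gegenbauer ?\<alpha> (j + 1)) = 0"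
      using zonal_integral_by_parts[OF assms(1), of "pderiv (gegenbauer ?\<alpha> (j + 1))"]
        gegenbauer_ode[of ?\<alpha> j] by (simp only: zonal_integral_smult[symmetric])
    moreover have "real (j + 1) * (real (j + 1) + 2 * ?\<alpha>) > 0"
      using assms(2) by (intro mult_pos_pos) (auto simp: field_simps)
    ultimately show ?thesis by (simp only: mult_eq_0_iff) linarith
  qed
qed (use assms in \<open>simp_all add: zonal_integral_add zonal_integral_smult\<close>)

section \<open>Positivity and the normalised kernel\<close>

lemma AE_sphere_measureD:
  fixes P :: "real ^ 'n \<Rightarrow> bool"
  assumes "AE y in sphere_measure. P y" and meas: "{y \<in> unit_sphere. P y} \<in> sets sphere_measure"
  shows "AE y in lborel. y \<in> cball 0 1 - {0} \<longrightarrow> P (y /\<^sub>R norm y)"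
proof -
  let ?R = "restrict_space lborel (cball 0 1 - {0}) :: (real ^ 'n) measure"
  let ?M = "distr ?R (restrict_space borel unit_sphere) (\<lambda>x. x /\<^sub>R norm x)"
  have "AE y in ?M. 0 < ennreal (real CARD('n)) \<longrightarrow> P y"
    using assms(1) unfolding sphere_measure_eq_density by (subst (asm) AE_density) auto
  then have "AE y in ?M. P y" by (simp add: ennreal_less_zero_iff)
  moreover have "{y \<in> space (restrict_space borel unit_sphere). P y} \<in> sets (restrict_space borel unit_sphere)"
    using meas by (simp add: space_restrict_space sets_sphere_measure)
  ultimately have "AE y in ?R. P (y /\<^sub>R norm y)"
    using AE_distr_iff[OF radial_projection_measurable] by blast
  then show ?thesis by (subst (asm) AE_restrict_space_iff) auto
qed

text \<open>If the integral were zero, \<open>q\<close> would vanish at the cosine of the angle to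
  \<open>x\<close> for almost every point of the ball. But it is nonzero on an open set around
  \<open>x / 2\<close>, where that cosine is near 1.\<close>

lemma zonal_integral_square_pos:
  fixes x :: "real ^ 'n"
  assumes x: "norm x = 1" and q: "poly q 1 \<noteq> 0"
  shows "zonal_integral x (q * q) > 0"
proof -
  have ge: "zonal_integral x (q * q) \<ge> 0" unfolding zonal_integral_def by simp
  have "zonal_integral x (q * q) \<noteq> 0"
  proof
    assume "zonal_integral x (q * q) = 0"
    then have "AE y in sphere_measure. poly (q * q) (x \<bullet> y) = 0"
      unfolding zonal_integral_def
      by (subst (asm) integral_nonneg_eq_0_iff_AE[OF integrable_zonal]) simp_all
    then have ae: "AE y in sphere_measure. poly q (x \<bullet> y) = 0" by simp
    have meas: "{y \<in> unit_sphere. poly q (x \<bullet> y) = 0} \<in> sets sphere_measure"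
    proof -
      have [measurable]: "(\<lambda>y. poly q (x \<bullet> y)) \<in> borel_measurable sphere_measure"
        by (intro measurable_sphere_measure continuous_on_poly_inner)
      have "{y \<in> space sphere_measure. poly q (x \<bullet> y) = 0} \<in> sets sphere_measure" by measurable
      then show ?thesis by simp
    qed
    define O1 where "O1 = (ball 0 1 - {0}) \<inter> (\<lambda>y. poly q (x \<bullet> (y /\<^sub>R norm y))) -` (- {0})"
    have "open O1"
      unfolding O1_def by (intro continuous_open_preimage continuous_intros) auto
    moreover have "x /\<^sub>R 2 \<in> O1"
      using x q by (auto simp: O1_def dot_square_norm)
    ultimately have "\<not> negligible O1" using open_not_negligible by auto
    moreover have "O1 \<in> null_sets lborel"
    proof (subst AE_iff_null_sets)
      show "O1 \<in> sets lborel" using \<open>open O1\<close> by simp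
      show "AE y in lborel. y \<notin> O1"
        using AE_sphere_measureD[OF ae meas] by eventually_elim (auto simp: O1_def)
    qed
    then have "negligible O1" by (simp add: negligible_iff_null_sets null_sets_completionI)
    ultimately show False by simp
  qed
  with ge show ?thesis by simp
qed

text \<open>By rotation invariance one constant normalises the kernel for all \<open>x\<close>. The
  mean is \<open>l\<close> because \<open>(t - l) q^2 = C q\<close> with \<open>q\<close> of degree
  \<open>k\<close>, below that of \<open>C\<close>.\<close>

lemma gegenbauer_kernel:
  fixes k :: nat
  assumes "CARD('n) \<ge> 3"
  defines "l \<equiv> largest_gegenbauer_root ((real CARD('n) - 2) / 2) (k + 1)"
  obtains u where "l < 1" "degree u = 2 * k" "\<And>t. poly u t \<ge> 0"
    "\<And>x :: real ^ 'n. norm x = 1 \<Longrightarrow> zonal_integral x u = 1"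
    "\<And>x :: real ^ 'n. norm x = 1 \<Longrightarrow> zonal_integral x ([:0, 1:] * u) = l"
proof -
  let ?\<alpha> = "(real CARD('n) - 2) / 2"
  have \<alpha>: "?\<alpha> > 0" using assms by simp
  define C where "C = gegenbauer ?\<alpha> (k + 1)"
  have degC: "degree C = k + 1" using gegenbauer_degree_lead_coeff[OF \<alpha>, of "k + 1"] by (simp add: C_def)
  have C1: "poly C 1 \<noteq> 0" using gegenbauer_at_1_pos[OF \<alpha>, of "k + 1"] by (simp add: C_def)
  have "poly C l = 0"
    unfolding C_def l_def
    by (rule poly_largest_gegenbauer_root[OF \<alpha>]) (use gegenbauer_interlacing[OF \<alpha>, of k] in blast)
  then obtain q where C: "C = [:- l, 1:] * q" by (auto simp: poly_eq_0_iff_dvd elim: dvdE)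
  have "q \<noteq> 0" using degC C by auto
  then have "degree C = 1 + degree q" unfolding C by (subst degree_mult_eq) auto
  then have degq: "degree q = k" using degC by simp
  have q1: "poly q 1 \<noteq> 0" using C1 C by auto
  have l1: "l \<noteq> 1" using C1 C by auto
  define e :: "real ^ 'n" where "e = axis undefined 1"
  have e: "norm e = 1" by (simp add: e_def)
  define c where "c = zonal_integral e (q * q)"
  have c: "c > 0" unfolding c_def using e q1 by (rule zonal_integral_square_pos)
  define u where "u = smult (1 / c) (q * q)"
  have int_u: "zonal_integral x u = 1" if "norm x = 1" for x :: "real ^ 'n"
    using c zonal_integral_rotate[of x e "q * q"] that e by (simp add: u_def zonal_integral_smult c_def)
  have int_tu: "zonal_integral x ([:0, 1:] * u) = l" if "norm x = 1" for x :: "real ^ 'n"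
  proof -
    have "zonal_integral x (C * q) = 0"
      unfolding C_def using that assms(1) degq by (intro zonal_integral_gegenbauer) auto
    moreover have "C * q = [:0, 1:] * (q * q) - smult l (q * q)"
      by (simp add: C algebra_simps)
    ultimately have "zonal_integral x ([:0, 1:] * (q * q)) = l * zonal_integral x (q * q)"
      by (simp only: zonal_integral_diff zonal_integral_smult)
    then have "zonal_integral x ([:0, 1:] * u) = l * zonal_integral x u"
      unfolding u_def mult_smult_right zonal_integral_smult by simp
    then show ?thesis using int_u[OF that] by simp
  qed
  have nonneg: "poly u t \<ge> 0" for t using c by (simp add: u_def)
  \<comment> \<open>The mean of a cosine is at most 1, so \<open>l \<le> 1\<close>; equality is
    excluded because \<open>C\<close> is positive at 1.\<close>
  have "zonal_integral e ([:0, 1:] * u) \<le> zonal_integral e u"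
    unfolding zonal_integral_def
  proof (rule integral_mono[OF integrable_zonal integrable_zonal])
    fix y assume "y \<in> space (sphere_measure :: (real ^ 'n) measure)"
    then have "e \<bullet> y \<le> 1" using norm_cauchy_schwarz[of e y] e by simp
    then show "poly ([:0, 1:] * u) (e \<bullet> y) \<le> poly u (e \<bullet> y)"
      using mult_right_mono[OF _ nonneg[of "e \<bullet> y"], of "e \<bullet> y" 1] by simp
  qed
  then have "l < 1" using int_u[OF e] int_tu[OF e] l1 by simp
  moreover have "degree u = 2 * k"
    using c \<open>q \<noteq> 0\<close> degq by (simp add: u_def degree_mult_eq)
  ultimately show ?thesis using nonneg int_u int_tu that by blast
qed

section \<open>The approximation error\<close>

text \<open>Jordan's inequality: a concave function lies above its chord.\<close>

lemma sin_ge_chord: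
  assumes "0 \<le> x" "x \<le> pi / 2"
  shows "2 / pi * x \<le> sin x"
proof -
  have "concave_on {0..pi / 2} sin"
    by (rule f''_le0_imp_concave[where f' = cos and f'' = "\<lambda>x. - sin x"])
      (auto intro!: derivative_eq_intros sin_ge_zero)
  from concave_onD_Icc'[OF this, of x] assms show ?thesis by simp
qed

text \<open>Half-angle formula and Jordan's inequality at half the angle. The constant is sharp:
  equality holds at \<open>t = -1\<close>.\<close>

lemma arccos_le_sqrt:
  assumes "-1 \<le> t" "t \<le> 1"
  shows "arccos t \<le> pi / sqrt 2 * sqrt (1 - t)"
proof -
  define \<theta> where "\<theta> = arccos t"
  have \<theta>: "0 \<le> \<theta>" "\<theta> \<le> pi" "cos \<theta> = t"
    using assms arccos_lbound arccos_ubound by (auto simp: \<theta>_def)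
  have "sin (\<theta> / 2) \<ge> 0" using \<theta> by (intro sin_ge_zero) auto
  have "1 - t = 2 * (sin (\<theta> / 2))\<^sup>2"
    using cos_double_sin[of "\<theta> / 2"] \<theta> by simp
  then have "sqrt (1 - t) = sqrt 2 * sin (\<theta> / 2)"
    using \<open>sin (\<theta> / 2) \<ge> 0\<close> by (simp add: real_sqrt_mult)
  then have "pi / sqrt 2 * sqrt (1 - t) = pi * sin (\<theta> / 2)" by simp
  moreover have "\<theta> \<le> pi * sin (\<theta> / 2)"
    using sin_ge_chord[of "\<theta> / 2"] \<theta> by (simp add: field_simps)
  ultimately show ?thesis by (simp add: \<theta>_def)
qed

lemma sphere_lipschitz_bound:
  assumes "sphere_lipschitz \<kappa> f" "norm x = 1" "norm y = 1"
  shows "\<bar>f x - f y\<bar> \<le> \<kappa> * (pi / sqrt 2 * sqrt (1 - x \<bullet> y))"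
proof -
  have "\<kappa> \<ge> 0" "\<bar>f x - f y\<bar> \<le> \<kappa> * arccos (x \<bullet> y)"
    using assms by (auto simp: sphere_lipschitz_def geodesic_dist_def)
  moreover have "arccos (x \<bullet> y) \<le> pi / sqrt 2 * sqrt (1 - x \<bullet> y)"
    using Cauchy_Schwarz_ineq2[of x y] assms by (intro arccos_le_sqrt) auto
  ultimately show ?thesis by (meson mult_left_mono order_trans)
qed

text \<open>The chord satisfies \<open>|x - y|^2 = 2 (1 - <x, y>)\<close>, so \<open>f\<close> is
  Lipschitz for the Euclidean distance as well. Continuity is what makes the integrands below
  integrable.\<close>

lemma sphere_lipschitz_continuous:
  fixes f :: "real ^ 'n \<Rightarrow> real"
  assumes f: "sphere_lipschitz \<kappa> f"
  shows "continuous_on unit_sphere f"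
proof -
  have "(\<kappa> * (pi / 2))-lipschitz_on unit_sphere f"
  proof (rule lipschitz_onI)
    show "0 \<le> \<kappa> * (pi / 2)" using f by (simp add: sphere_lipschitz_def)
    fix x y :: "real ^ 'n" assume xy: "x \<in> unit_sphere" "y \<in> unit_sphere"
    then have "(dist x y)\<^sup>2 = 2 * (1 - x \<bullet> y)"
      by (simp add: dist_norm power2_norm_eq_inner inner_diff_left inner_diff_right inner_commute
          norm_eq_1)
    then have "1 - x \<bullet> y = (dist x y)\<^sup>2 / 2" by simp
    then have "sqrt (1 - x \<bullet> y) = dist x y / sqrt 2" by (simp only: real_sqrt_divide) simp
    then have "pi / sqrt 2 * sqrt (1 - x \<bullet> y) = pi / 2 * dist x y" by simp
    then show "dist (f x) (f y) \<le> \<kappa> * (pi / 2) * dist x y"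
      using sphere_lipschitz_bound[OF f, of x y] xy by (simp only: dist_real_def mult.assoc) simp
  qed
  then show ?thesis by (rule lipschitz_on_continuous_on)
qed

text \<open>Instead of Jensen's inequality for the square root, its tangent at \<open>s\<^sup>2\<close> is used.\<close>
lemma convolution_error_bound:
  fixes f :: "real ^ 'n \<Rightarrow> real" and x :: "real ^ 'n"
  assumes f: "sphere_lipschitz \<kappa> f" and x: "norm x = 1" and u: "\<And>t. poly u t \<ge> 0"
    and mass: "zonal_integral x u = 1" and mean: "zonal_integral x ([:0, 1:] * u) = l" and "l < 1"
  shows "\<bar>f x - convolution_op u f x\<bar> \<le> pi / sqrt 2 * sqrt (1 - l) * \<kappa>"
proof -
  note cont = sphere_lipschitz_continuous[OF f]
  define s where "s = sqrt (1 - l)"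
  have s: "s > 0" "s * s = 1 - l" using \<open>l < 1\<close> by (simp_all add: s_def)
  define K where "K = \<kappa> * pi / sqrt 2"
  have K: "K \<ge> 0" using f by (simp add: K_def sphere_lipschitz_def)
  have int_f: "integrable sphere_measure (\<lambda>y. poly u (x \<bullet> y) * f y)"
    by (intro integrable_sphere_measure continuous_intros cont)
  have "f x - convolution_op u f x =
      (LINT y|sphere_measure. poly u (x \<bullet> y) * f x) - (LINT y|sphere_measure. poly u (x \<bullet> y) * f y)"
    using mass by (simp add: convolution_op_def zonal_integral_def)
  also have "\<dots> = (LINT y|sphere_measure. poly u (x \<bullet> y) * f x - poly u (x \<bullet> y) * f y)"
    by (rule Bochner_Integration.integral_diff[symmetric])
      (intro integrable_sphere_measure continuous_intros cont)+
  also have "\<bar>\<dots>\<bar> \<le> (LINT y|sphere_measure. \<bar>poly u (x \<bullet> y) * f x - poly u (x \<bullet> y) * f y\<bar>)"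
    by (rule integral_abs_bound)
  \<comment> \<open>The tangent bound is affine in \<open><x, y>\<close>, so the majorant is a
    polynomial whose integral depends only on the mass and mean of \<open>u\<close>.\<close>
  also have "\<dots> \<le> (LINT y|sphere_measure. poly (smult (K / 2) (smult (1 / s) (u - [:0, 1:] * u) + smult s u)) (x \<bullet> y))"
  proof (rule integral_mono)
    show "integrable sphere_measure (\<lambda>y. \<bar>poly u (x \<bullet> y) * f x - poly u (x \<bullet> y) * f y\<bar>)"
      by (intro integrable_sphere_measure continuous_intros cont)
    fix y assume "y \<in> space (sphere_measure :: (real ^ 'n) measure)"
    then have y: "norm y = 1" by simp
    define r where "r = sqrt (1 - x \<bullet> y)"
    have r: "r * r = 1 - x \<bullet> y"
      using norm_cauchy_schwarz[of x y] x y by (simp add: r_def)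
    have "0 \<le> (r - s)\<^sup>2 / s" using s by simp
    also have "(r - s)\<^sup>2 / s = (1 - x \<bullet> y) / s + s - 2 * r"
      using s by (simp add: r[symmetric] power2_eq_square field_simps)
    finally have r_le: "r \<le> ((1 - x \<bullet> y) / s + s) / 2" by simp
    have "\<bar>f x - f y\<bar> \<le> K * r"
      using sphere_lipschitz_bound[OF f x y] by (simp add: K_def r_def)
    also have "\<dots> \<le> K * (((1 - x \<bullet> y) / s + s) / 2)"
      using r_le K by (rule mult_left_mono)
    finally have "poly u (x \<bullet> y) * \<bar>f x - f y\<bar> \<le> poly u (x \<bullet> y) * (K * (((1 - x \<bullet> y) / s + s) / 2))"
      using u by (intro mult_left_mono) auto
    moreover have "\<bar>poly u (x \<bullet> y) * f x - poly u (x \<bullet> y) * f y\<bar> = poly u (x \<bullet> y) * \<bar>f x - f y\<bar>"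
      using u by (simp add: abs_mult flip: right_diff_distrib)
    moreover have "poly u (x \<bullet> y) * (K * (((1 - x \<bullet> y) / s + s) / 2)) =
        poly (smult (K / 2) (smult (1 / s) (u - [:0, 1:] * u) + smult s u)) (x \<bullet> y)"
      by (simp add: algebra_simps add_divide_distrib diff_divide_distrib)
    ultimately show "\<bar>poly u (x \<bullet> y) * f x - poly u (x \<bullet> y) * f y\<bar> \<le>
        poly (smult (K / 2) (smult (1 / s) (u - [:0, 1:] * u) + smult s u)) (x \<bullet> y)"
      by (simp only:)
  qed (rule integrable_zonal)
  also have "\<dots> = K / 2 * (1 / s * (1 - l) + s)"
    unfolding zonal_integral_def[symmetric] zonal_integral_smult zonal_integral_add
      zonal_integral_diff mass mean by simp
  also have "\<dots> = K * s" using s by (simp flip: s(2))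
  finally show ?thesis by (simp add: K_def s_def mult_ac)
qed

section \<open>The error bound and its asymptotics\<close>

theorem theorem3p1:
  fixes f :: "real ^ 'n \<Rightarrow> real" and \<kappa> :: real
  assumes "CARD('n) \<ge> 3"
    and "sphere_lipschitz \<kappa> f"
  shows "(\<forall>d k :: nat. k > 0 \<and> d = 2 * k \<longrightarrow>
            (\<exists>u :: real poly. degree u = d \<and> (\<forall>t\<in>{-1..1}. poly u t \<ge> 0) \<and>
               sphere_sup_norm (\<lambda>x. f x - convolution_op u f x)
                 \<le> ereal ((pi / sqrt 2 * sqrt (1 - largest_gegenbauer_root ((real CARD('n) - 2) / 2) (k + 1))) * \<kappa>))) \<and>
         (\<kappa> > 0 \<longrightarrow>
            \<bar>limsup (\<lambda>k :: nat. ereal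
               (((pi / sqrt 2 * sqrt (1 - largest_gegenbauer_root ((real CARD('n) - 2) / 2) (k + 1))) * \<kappa>) /
                (pi * (real CARD('n) - 2) / sqrt 2 * (\<kappa> / real (2 * k)))))\<bar> \<noteq> \<infinity>)"
proof (intro conjI allI impI)
  fix d k :: nat assume k: "k > 0 \<and> d = 2 * k"
  define l where "l = largest_gegenbauer_root ((real CARD('n) - 2) / 2) (k + 1)"
  obtain u where u: "l < 1" "degree u = 2 * k" "\<And>t. poly u t \<ge> 0"
    "\<And>x :: real ^ 'n. norm x = 1 \<Longrightarrow> zonal_integral x u = 1"
    "\<And>x :: real ^ 'n. norm x = 1 \<Longrightarrow> zonal_integral x ([:0, 1:] * u) = l"
    using gegenbauer_kernel[OF assms(1), of k] unfolding l_def by blast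
  have "sphere_sup_norm (\<lambda>x. f x - convolution_op u f x) \<le> ereal (pi / sqrt 2 * sqrt (1 - l) * \<kappa>)"
    unfolding sphere_sup_norm_def
  proof (rule SUP_least)
    fix x :: "real ^ 'n" assume "x \<in> unit_sphere"
    then have "norm x = 1" by simp
    then show "ereal \<bar>f x - convolution_op u f x\<bar> \<le> ereal (pi / sqrt 2 * sqrt (1 - l) * \<kappa>)"
      using convolution_error_bound[OF assms(2) _ u(3) u(4) u(5) u(1)] by simp
  qed
  then show "\<exists>u :: real poly. degree u = d \<and> (\<forall>t\<in>{-1..1}. poly u t \<ge> 0) \<and>
      sphere_sup_norm (\<lambda>x. f x - convolution_op u f x)
        \<le> ereal ((pi / sqrt 2 * sqrt (1 - largest_gegenbauer_root ((real CARD('n) - 2) / 2) (k + 1))) * \<kappa>)"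
    unfolding l_def[symmetric] using u(2,3) k by blast
next
  assume \<kappa>: "\<kappa> > 0"
  define N where "N = CARD('n) - 2"
  have N: "N \<ge> 1" "real CARD('n) - 2 = real N" using assms(1) by (auto simp: N_def of_nat_diff)
  define l where "l k = largest_gegenbauer_root (real N / 2) (k + 1)" for k
  define D :: real where "D = 27 * 4 ^ (N - 1)"
  \<comment> \<open>With \<open>q = k div 4\<close>, the root bound gives \<open>sqrt D / q\<close>
    and \<open>k \<le> 8 q\<close> gives \<open>2 k / N \<le> 16 q / N\<close>; \<open>B\<close> is
    the product.\<close>
  define B where "B = sqrt D * 16 / real N"
  define a where "a k = pi / sqrt 2 * sqrt (1 - l k) * \<kappa> / (pi * real N / sqrt 2 * (\<kappa> / real (2 * k)))" for k
  \<comment> \<open>From \<open>k = 4\<close> on, \<open>q\<close> is positive. The limsup ignores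
    smaller \<open>k\<close>, among them \<open>k = 0\<close>, where the ratio divides by
    zero.\<close>
  have bounds: "0 \<le> a k \<and> a k \<le> B" if k: "k \<ge> 4" for k
  proof -
    define q where "q = k div 4"
    have q: "q \<ge> 1" "4 * q \<le> k" "k \<le> 8 * q" using k unfolding q_def by presburger+
    have "l k < 1"
      using gegenbauer_kernel[OF assms(1), of k] unfolding l_def N(2) by blast
    have a: "a k = sqrt (1 - l k) * (2 * real k / real N)"
      using \<kappa> k N(1) by (simp add: a_def field_simps)
    have "1 - l k \<le> D / (real q)\<^sup>2"
      using largest_gegenbauer_root_lower_bound[OF N(1) q(1,2)] by (simp add: l_def D_def)
    then have "sqrt (1 - l k) \<le> sqrt (D / (real q)\<^sup>2)" by (rule real_sqrt_le_mono)
    also have "\<dots> = sqrt D / real q" by (simp add: real_sqrt_divide)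
    finally have "a k \<le> sqrt D / real q * (2 * real (8 * q) / real N)"
      unfolding a using q by (intro mult_mono divide_right_mono) (auto simp: D_def)
    also have "\<dots> = B" using q by (simp add: B_def field_simps)
    finally show ?thesis using \<open>l k < 1\<close> a by simp
  qed
  have ev: "\<forall>\<^sub>F k in sequentially. 0 \<le> a k \<and> a k \<le> B"
    using bounds by (auto simp: eventually_sequentially)
  have "limsup (\<lambda>k. ereal (a k)) \<le> ereal B"
    by (rule Limsup_bounded) (use ev in \<open>auto elim: eventually_mono\<close>)
  moreover have "ereal 0 \<le> limsup (\<lambda>k. ereal (a k))"
    by (rule le_Limsup) (use ev in \<open>auto elim: eventually_mono\<close>)
  ultimately have "\<bar>limsup (\<lambda>k. ereal (a k))\<bar> \<noteq> \<infinity>" by auto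
  then show "\<bar>limsup (\<lambda>k :: nat. ereal
      (((pi / sqrt 2 * sqrt (1 - largest_gegenbauer_root ((real CARD('n) - 2) / 2) (k + 1))) * \<kappa>) /
       (pi * (real CARD('n) - 2) / sqrt 2 * (\<kappa> / real (2 * k)))))\<bar> \<noteq> \<infinity>"
    unfolding a_def l_def N(2) .
qed

end
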